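(* Let $\mathcal{C}$ be a pre-rigid braided monoidal category. If $\overline{(-)^*}:\mathsf{Alg}(\mathcal{C}^{\mathrm{op}})\to\mathsf{Alg}(\mathcal{C})$ has a left adjoint, then $\big((-)^*:\mathcal{C}\to\mathcal{C}^{\mathrm{op}},\ (-)^*:\mathcal{C}^{\mathrm{op}}\to\mathcal{C}\big)$ is a liftable pair of adjoint functors.
   Context: A monoidal category $(\mathcal{C},\otimes,\mathbb{I})$ is (right) pre-rigid if for every object $X$ there are an object $X^*$ (a pre-dual of $X$) and a morphism $\mathrm{ev}_X:X^*\otimes X\to\mathbb{I}$ such that for every object $T$ the map $\mathrm{Hom}_{\mathcal{C}}(T,X^* )\to\mathrm{Hom}_{\mathcal{C}}(T\otimes X,\mathbb{I})$, $u\mapsto \mathrm{ev}_X\circ(u\otimes X)$, is bijective; write $t\mapsto t^\dagger$ for the inverse bijection. Here $X$ also denotes the identity morphism of $X$. Associativity and unit constraints are suppressed. Let $c$ be the braiding of $\mathcal{C}$. $\mathcal{C}^{\mathrm{op}}$ is monoidal with $X^{\mathrm{op}}\otimes Y^{\mathrm{op}}=(X\otimes Y)^{\mathrm{op}}$ and unit $\mathbb{I}^{\mathrm{op}}$. The functor $R=(-)^*:\mathcal{C}^{\mathrm{op}}\to\mathcal{C}$ sends $X^{\mathrm{op}}$ to $X^*$ and, for $f:X\to Y$, $f^{\mathrm{op}}$ to the unique $f^*:Y^*\to X^*$ with $\mathrm{ev}_X\circ(f^*\otimes X)=\mathrm{ev}_Y\circ(Y^*\otimes f)$. It is lax monoidal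 via $\phi_2(X^{\mathrm{op}},Y^{\mathrm{op}})=\big((\mathrm{ev}_X\otimes\mathrm{ev}_Y)\circ(X^*\otimes (c_{X,Y^*})^{-1}\otimes Y)\big)^\dagger:X^*\otimes Y^*\to(X\otimes Y)^*$ and $\phi_0=(m_{\mathbb{I}})^\dagger:\mathbb{I}\to\mathbb{I}^*$, where $m_{\mathbb{I}}:\mathbb{I}\otimes\mathbb{I}\to\mathbb{I}$ is the canonical isomorphism. It has left adjoint $L=R^{\mathrm{op}}=(-)^*:\mathcal{C}\to\mathcal{C}^{\mathrm{op}}$, with unit $\eta_X=(\mathrm{ev}_X\circ c_{X,X^*})^\dagger:X\to X^{**}$ and counit $\epsilon_{X^{\mathrm{op}}}=(j_X)^{\mathrm{op}}$, $j_X=(\mathrm{ev}_X\circ(c_{X^*,X})^{-1})^\dagger:X\to X^{**}$. $\mathsf{Alg}(\mathcal{A})$ and $\mathsf{Coalg}(\mathcal{A})$ denote the categories of algebra (monoid) and coalgebra (comonoid) objects of a monoidal category $\mathcal{A}$. A lax monoidal functor $R:\mathcal{A}\to\mathcal{B}$ induces $\overline{R}=\mathsf{Alg}(R):\mathsf{Alg}(\mathcal{A})\to\mathsf{Alg}(\mathcal{B})$, $(A,m,u)\mapsto(RA,Rm\circ\phi_2(A,A),Ru\circ\phi_0)$. If $R$ has a left adjoint $L$ with unit $\eta$ and counit $\epsilon$, then $L$ is colax monoidal via $\psi_2(X,Y)=\epsilon_{LX\otimes LY}\circ L\phi_2(LX,LY)\circ L(\eta_X\otimes\eta_Y)$, $\psi_0=\epsilon_{\mathbb{I}_{\mathcal{A}}}\circ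 L\phi_0$, and induces $\underline{L}=\mathsf{Coalg}(L):\mathsf{Coalg}(\mathcal{B})\to\mathsf{Coalg}(\mathcal{A})$, $(C,\Delta,\varepsilon)\mapsto(LC,\psi_2(C,C)\circ L\Delta,\psi_0\circ L\varepsilon)$. The pair $(L,R)$ is called liftable if $\overline{R}$ has a left adjoint and $\underline{L}$ has a right adjoint. *)

theory Defs
  imports Main
begin

section \<open>Categories, functors and adjunctions\<close>

record ('o, 'm) category_data =
  Obj :: "'o set"
  Arr :: "'m set"
  src :: "'m \<Rightarrow> 'o"
  trg :: "'m \<Rightarrow> 'o"
  ide :: "'o \<Rightarrow> 'm"
  cmp :: "'m \<Rightarrow> 'm \<Rightarrow> 'm"  (infixl "\<cdot>\<index>" 55)

definition hom :: "('o, 'm, 'x) category_data_scheme \<Rightarrow> 'o \<Rightarrow> 'o \<Rightarrow> 'm set" where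
  "hom C X Y = {f \<in> Arr C. src C f = X \<and> trg C f = Y}"

locale category =
  fixes C :: "('o, 'm, 'x) category_data_scheme" (structure)
  assumes src_Obj: "f \<in> Arr C \<Longrightarrow> src C f \<in> Obj C"
    and trg_Obj: "f \<in> Arr C \<Longrightarrow> trg C f \<in> Obj C"
    and ide_hom: "X \<in> Obj C \<Longrightarrow> ide C X \<in> hom C X X"
    and cmp_hom: "f \<in> hom C X Y \<Longrightarrow> g \<in> hom C Y Z \<Longrightarrow> g \<cdot> f \<in> hom C X Z"
    and cmp_ide_right: "f \<in> hom C X Y \<Longrightarrow> f \<cdot> ide C X = f"
    and cmp_ide_left: "f \<in> hom C X Y \<Longrightarrow> ide C Y \<cdot> f = f"
    and cmp_assoc: "f \<in> hom C W X \<Longrightarrow> g \<in> hom C X Y \<Longrightarrow> h \<in> hom C Y Z \<Longrightarrow>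
          (h \<cdot> g) \<cdot> f = h \<cdot> (g \<cdot> f)"

definition inverse_arrows :: "('o, 'm, 'x) category_data_scheme \<Rightarrow> 'm \<Rightarrow> 'm \<Rightarrow> bool" where
  "inverse_arrows C f g \<longleftrightarrow>
     f \<in> Arr C \<and> g \<in> hom C (trg C f) (src C f) \<and>
     g \<cdot>\<^bsub>C\<^esub> f = ide C (src C f) \<and> f \<cdot>\<^bsub>C\<^esub> g = ide C (trg C f)"

definition iso :: "('o, 'm, 'x) category_data_scheme \<Rightarrow> 'm \<Rightarrow> bool" where
  "iso C f \<longleftrightarrow> (\<exists>g. inverse_arrows C f g)"

definition inv_arr :: "('o, 'm, 'x) category_data_scheme \<Rightarrow> 'm \<Rightarrow> 'm" where
  "inv_arr C f = (THE g. inverse_arrows C f g)"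

record ('o, 'm, 'p, 'n) functor_data =
  fobj :: "'o \<Rightarrow> 'p"
  farr :: "'m \<Rightarrow> 'n"

locale is_functor = A: category A + B: category B
  for A :: "('o, 'm, 'x) category_data_scheme"
    and B :: "('p, 'n, 'y) category_data_scheme"
    and F :: "('o, 'm, 'p, 'n) functor_data" +
  assumes fobj_Obj: "X \<in> Obj A \<Longrightarrow> fobj F X \<in> Obj B"
    and farr_hom: "f \<in> hom A X Y \<Longrightarrow> farr F f \<in> hom B (fobj F X) (fobj F Y)"
    and farr_ide: "X \<in> Obj A \<Longrightarrow> farr F (ide A X) = ide B (fobj F X)"
    and farr_cmp: "f \<in> hom A X Y \<Longrightarrow> g \<in> hom A Y Z \<Longrightarrow>
          farr F (g \<cdot>\<^bsub>A\<^esub> f) = farr F g \<cdot>\<^bsub>B\<^esub> farr F f"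

text \<open>\<open>L : B \<rightarrow> A\<close> is left adjoint to \<open>R : A \<rightarrow> B\<close>, with unit \<open>\<eta>\<close> and counit \<open>\<epsilon>\<close>.\<close>

locale adjunction = R: is_functor A B R + L: is_functor B A L
  for A :: "('o, 'm, 'x) category_data_scheme"
    and B :: "('p, 'n, 'y) category_data_scheme"
    and L :: "('p, 'n, 'o, 'm) functor_data"
    and R :: "('o, 'm, 'p, 'n) functor_data"
    and \<eta> :: "'p \<Rightarrow> 'n"
    and \<epsilon> :: "'o \<Rightarrow> 'm" +
  assumes unit_hom: "X \<in> Obj B \<Longrightarrow> \<eta> X \<in> hom B X (fobj R (fobj L X))"
    and unit_natural: "f \<in> hom B X X' \<Longrightarrow>
          \<eta> X' \<cdot>\<^bsub>B\<^esub> f = farr R (farr L f) \<cdot>\<^bsub>B\<^esub> \<eta> X"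
    and counit_hom: "Y \<in> Obj A \<Longrightarrow> \<epsilon> Y \<in> hom A (fobj L (fobj R Y)) Y"
    and counit_natural: "g \<in> hom A Y Y' \<Longrightarrow>
          \<epsilon> Y' \<cdot>\<^bsub>A\<^esub> farr L (farr R g) = g \<cdot>\<^bsub>A\<^esub> \<epsilon> Y"
    and triangle_L: "X \<in> Obj B \<Longrightarrow>
          \<epsilon> (fobj L X) \<cdot>\<^bsub>A\<^esub> farr L (\<eta> X) = ide A (fobj L X)"
    and triangle_R: "Y \<in> Obj A \<Longrightarrow>
          farr R (\<epsilon> Y) \<cdot>\<^bsub>B\<^esub> \<eta> (fobj R Y) = ide B (fobj R Y)"

definition has_left_adjoint ::
  "('o, 'm, 'x) category_data_scheme \<Rightarrow> ('p, 'n, 'y) category_data_scheme \<Rightarrow>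
   ('o, 'm, 'p, 'n) functor_data \<Rightarrow> bool" where
  "has_left_adjoint A B R \<longleftrightarrow> (\<exists>L \<eta> \<epsilon>. adjunction A B L R \<eta> \<epsilon>)"

definition has_right_adjoint ::
  "('p, 'n, 'y) category_data_scheme \<Rightarrow> ('o, 'm, 'x) category_data_scheme \<Rightarrow>
   ('p, 'n, 'o, 'm) functor_data \<Rightarrow> bool" where
  "has_right_adjoint B A L \<longleftrightarrow> (\<exists>R \<eta> \<epsilon>. adjunction A B L R \<eta> \<epsilon>)"

section \<open>Monoidal and braided categories\<close>

record ('o, 'm) monoidal_data = "('o, 'm) category_data" +
  tens_obj :: "'o \<Rightarrow> 'o \<Rightarrow> 'o"  (infixr "\<odot>\<index>" 70)
  tens :: "'m \<Rightarrow> 'm \<Rightarrow> 'm"  (infixr "\<otimes>\<index>" 70)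
  unit_obj :: "'o"
  assoc :: "'o \<Rightarrow> 'o \<Rightarrow> 'o \<Rightarrow> 'm"
  lunit :: "'o \<Rightarrow> 'm"
  runit :: "'o \<Rightarrow> 'm"

locale monoidal_category = category C
  for C :: "('o, 'm, 'x) monoidal_data_scheme" (structure) +
  assumes tens_Obj: "X \<in> Obj C \<Longrightarrow> Y \<in> Obj C \<Longrightarrow> X \<odot> Y \<in> Obj C"
    and tens_hom: "f \<in> hom C X X' \<Longrightarrow> g \<in> hom C Y Y' \<Longrightarrow> f \<otimes> g \<in> hom C (X \<odot> Y) (X' \<odot> Y')"
    and tens_ide: "X \<in> Obj C \<Longrightarrow> Y \<in> Obj C \<Longrightarrow> ide C X \<otimes> ide C Y = ide C (X \<odot> Y)"
    and tens_cmp: "f \<in> hom C X X' \<Longrightarrow> f' \<in> hom C X' X'' \<Longrightarrow>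
          g \<in> hom C Y Y' \<Longrightarrow> g' \<in> hom C Y' Y'' \<Longrightarrow>
          (f' \<cdot> f) \<otimes> (g' \<cdot> g) = (f' \<otimes> g') \<cdot> (f \<otimes> g)"
    and unit_Obj: "unit_obj C \<in> Obj C"
    and assoc_hom: "X \<in> Obj C \<Longrightarrow> Y \<in> Obj C \<Longrightarrow> Z \<in> Obj C \<Longrightarrow>
          assoc C X Y Z \<in> hom C ((X \<odot> Y) \<odot> Z) (X \<odot> (Y \<odot> Z))"
    and assoc_iso: "X \<in> Obj C \<Longrightarrow> Y \<in> Obj C \<Longrightarrow> Z \<in> Obj C \<Longrightarrow> iso C (assoc C X Y Z)"
    and assoc_natural: "f \<in> hom C X X' \<Longrightarrow> g \<in> hom C Y Y' \<Longrightarrow> h \<in> hom C Z Z' \<Longrightarrow>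
          assoc C X' Y' Z' \<cdot> ((f \<otimes> g) \<otimes> h) = (f \<otimes> (g \<otimes> h)) \<cdot> assoc C X Y Z"
    and lunit_hom: "X \<in> Obj C \<Longrightarrow> lunit C X \<in> hom C (unit_obj C \<odot> X) X"
    and lunit_iso: "X \<in> Obj C \<Longrightarrow> iso C (lunit C X)"
    and lunit_natural: "f \<in> hom C X Y \<Longrightarrow>
          lunit C Y \<cdot> (ide C (unit_obj C) \<otimes> f) = f \<cdot> lunit C X"
    and runit_hom: "X \<in> Obj C \<Longrightarrow> runit C X \<in> hom C (X \<odot> unit_obj C) X"
    and runit_iso: "X \<in> Obj C \<Longrightarrow> iso C (runit C X)"
    and runit_natural: "f \<in> hom C X Y \<Longrightarrow>
          runit C Y \<cdot> (f \<otimes> ide C (unit_obj C)) = f \<cdot> runit C X"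
    and pentagon: "W \<in> Obj C \<Longrightarrow> X \<in> Obj C \<Longrightarrow> Y \<in> Obj C \<Longrightarrow> Z \<in> Obj C \<Longrightarrow>
          (ide C W \<otimes> assoc C X Y Z) \<cdot> assoc C W (X \<odot> Y) Z \<cdot> (assoc C W X Y \<otimes> ide C Z)
          = assoc C W X (Y \<odot> Z) \<cdot> assoc C (W \<odot> X) Y Z"
    and triangle: "X \<in> Obj C \<Longrightarrow> Y \<in> Obj C \<Longrightarrow>
          (ide C X \<otimes> lunit C Y) \<cdot> assoc C X (unit_obj C) Y = runit C X \<otimes> ide C Y"

text \<open>The canonical isomorphism \<open>I \<otimes> I \<rightarrow> I\<close>; the left and right unit constraints agree at \<open>I\<close>.\<close>

definition unit_mult :: "('o, 'm, 'x) monoidal_data_scheme \<Rightarrow> 'm" where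
  "unit_mult C = lunit C (unit_obj C)"

text \<open>The opposite monoidal category has the same objects, arrows and tensor product; its
  constraints are the inverses of the given ones.\<close>

definition op_mon :: "('o, 'm, 'x) monoidal_data_scheme \<Rightarrow> ('o, 'm) monoidal_data" where
  "op_mon C =
    \<lparr> Obj = Obj C, Arr = Arr C, src = trg C, trg = src C, ide = ide C,
      cmp = (\<lambda>g f. f \<cdot>\<^bsub>C\<^esub> g),
      tens_obj = tens_obj C, tens = tens C, unit_obj = unit_obj C,
      assoc = (\<lambda>X Y Z. inv_arr C (assoc C X Y Z)),
      lunit = (\<lambda>X. inv_arr C (lunit C X)),
      runit = (\<lambda>X. inv_arr C (runit C X)) \<rparr>"

record ('o, 'm) braided_data = "('o, 'm) monoidal_data" +
  braid :: "'o \<Rightarrow> 'o \<Rightarrow> 'm"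

locale braided_monoidal_category = monoidal_category C
  for C :: "('o, 'm, 'x) braided_data_scheme" (structure) +
  assumes braid_hom: "X \<in> Obj C \<Longrightarrow> Y \<in> Obj C \<Longrightarrow> braid C X Y \<in> hom C (X \<odot> Y) (Y \<odot> X)"
    and braid_iso: "X \<in> Obj C \<Longrightarrow> Y \<in> Obj C \<Longrightarrow> iso C (braid C X Y)"
    and braid_natural: "f \<in> hom C X X' \<Longrightarrow> g \<in> hom C Y Y' \<Longrightarrow>
          braid C X' Y' \<cdot> (f \<otimes> g) = (g \<otimes> f) \<cdot> braid C X Y"
    and hexagon1: "X \<in> Obj C \<Longrightarrow> Y \<in> Obj C \<Longrightarrow> Z \<in> Obj C \<Longrightarrow>
          assoc C Y Z X \<cdot> braid C X (Y \<odot> Z) \<cdot> assoc C X Y Z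
          = (ide C Y \<otimes> braid C X Z) \<cdot> assoc C Y X Z \<cdot> (braid C X Y \<otimes> ide C Z)"
    and hexagon2: "X \<in> Obj C \<Longrightarrow> Y \<in> Obj C \<Longrightarrow> Z \<in> Obj C \<Longrightarrow>
          inv_arr C (assoc C Z X Y) \<cdot> braid C (X \<odot> Y) Z \<cdot> inv_arr C (assoc C X Y Z)
          = (braid C X Z \<otimes> ide C Y) \<cdot> inv_arr C (assoc C X Z Y) \<cdot> (ide C X \<otimes> braid C Y Z)"

section \<open>Algebras, coalgebras and lax monoidal functors\<close>

text \<open>Algebras \<open>(A, m, u)\<close> and coalgebras \<open>(C, \<Delta>, \<epsilon>)\<close> are triples. Their morphisms carry
  source and target, since one arrow of the base category can be a morphism between several
  pairs of (co)algebras.\<close>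

type_synonym ('o, 'm) structured = "'o \<times> 'm \<times> 'm"
type_synonym ('o, 'm) structured_arr = "('o, 'm) structured \<times> ('o, 'm) structured \<times> 'm"

definition is_algebra :: "('o, 'm, 'x) monoidal_data_scheme \<Rightarrow> ('o, 'm) structured \<Rightarrow> bool" where
  "is_algebra C = (\<lambda>(A, m, u).
     A \<in> Obj C \<and> m \<in> hom C (A \<odot>\<^bsub>C\<^esub> A) A \<and> u \<in> hom C (unit_obj C) A \<and>
     m \<cdot>\<^bsub>C\<^esub> (m \<otimes>\<^bsub>C\<^esub> ide C A) = m \<cdot>\<^bsub>C\<^esub> (ide C A \<otimes>\<^bsub>C\<^esub> m) \<cdot>\<^bsub>C\<^esub> assoc C A A A \<and>
     m \<cdot>\<^bsub>C\<^esub> (u \<otimes>\<^bsub>C\<^esub> ide C A) = lunit C A \<and>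
     m \<cdot>\<^bsub>C\<^esub> (ide C A \<otimes>\<^bsub>C\<^esub> u) = runit C A)"

definition is_algebra_arr ::
  "('o, 'm, 'x) monoidal_data_scheme \<Rightarrow> ('o, 'm) structured_arr \<Rightarrow> bool" where
  "is_algebra_arr C = (\<lambda>((A, m, u), (A', m', u'), f).
     is_algebra C (A, m, u) \<and> is_algebra C (A', m', u') \<and> f \<in> hom C A A' \<and>
     f \<cdot>\<^bsub>C\<^esub> m = m' \<cdot>\<^bsub>C\<^esub> (f \<otimes>\<^bsub>C\<^esub> f) \<and> f \<cdot>\<^bsub>C\<^esub> u = u')"

definition is_coalgebra :: "('o, 'm, 'x) monoidal_data_scheme \<Rightarrow> ('o, 'm) structured \<Rightarrow> bool" where
  "is_coalgebra C = (\<lambda>(D, \<Delta>, e).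
     D \<in> Obj C \<and> \<Delta> \<in> hom C D (D \<odot>\<^bsub>C\<^esub> D) \<and> e \<in> hom C D (unit_obj C) \<and>
     assoc C D D D \<cdot>\<^bsub>C\<^esub> (\<Delta> \<otimes>\<^bsub>C\<^esub> ide C D) \<cdot>\<^bsub>C\<^esub> \<Delta> = (ide C D \<otimes>\<^bsub>C\<^esub> \<Delta>) \<cdot>\<^bsub>C\<^esub> \<Delta> \<and>
     lunit C D \<cdot>\<^bsub>C\<^esub> (e \<otimes>\<^bsub>C\<^esub> ide C D) \<cdot>\<^bsub>C\<^esub> \<Delta> = ide C D \<and>
     runit C D \<cdot>\<^bsub>C\<^esub> (ide C D \<otimes>\<^bsub>C\<^esub> e) \<cdot>\<^bsub>C\<^esub> \<Delta> = ide C D)"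

definition is_coalgebra_arr ::
  "('o, 'm, 'x) monoidal_data_scheme \<Rightarrow> ('o, 'm) structured_arr \<Rightarrow> bool" where
  "is_coalgebra_arr C = (\<lambda>((D, \<Delta>, e), (D', \<Delta>', e'), f).
     is_coalgebra C (D, \<Delta>, e) \<and> is_coalgebra C (D', \<Delta>', e') \<and> f \<in> hom C D D' \<and>
     \<Delta>' \<cdot>\<^bsub>C\<^esub> f = (f \<otimes>\<^bsub>C\<^esub> f) \<cdot>\<^bsub>C\<^esub> \<Delta> \<and> e' \<cdot>\<^bsub>C\<^esub> f = e)"

definition Alg ::
  "('o, 'm, 'x) monoidal_data_scheme \<Rightarrow>
   (('o, 'm) structured, ('o, 'm) structured_arr) category_data" where
  "Alg C =
    \<lparr> Obj = {S. is_algebra C S}, Arr = {a. is_algebra_arr C a},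
      src = (\<lambda>(S, T, f). S), trg = (\<lambda>(S, T, f). T),
      ide = (\<lambda>S. (S, S, ide C (fst S))),
      cmp = (\<lambda>(S', T', g) (S, T, f). (S, T', g \<cdot>\<^bsub>C\<^esub> f)) \<rparr>"

definition Coalg ::
  "('o, 'm, 'x) monoidal_data_scheme \<Rightarrow>
   (('o, 'm) structured, ('o, 'm) structured_arr) category_data" where
  "Coalg C =
    \<lparr> Obj = {S. is_coalgebra C S}, Arr = {a. is_coalgebra_arr C a},
      src = (\<lambda>(S, T, f). S), trg = (\<lambda>(S, T, f). T),
      ide = (\<lambda>S. (S, S, ide C (fst S))),
      cmp = (\<lambda>(S', T', g) (S, T, f). (S, T', g \<cdot>\<^bsub>C\<^esub> f)) \<rparr>"

locale lax_monoidal_functor =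
  A: monoidal_category A + B: monoidal_category B + is_functor A B R
  for A :: "('o, 'm, 'x) monoidal_data_scheme"
    and B :: "('p, 'n, 'y) monoidal_data_scheme"
    and R :: "('o, 'm, 'p, 'n) functor_data"
    and \<phi>2 :: "'o \<Rightarrow> 'o \<Rightarrow> 'n"
    and \<phi>0 :: 'n +
  assumes phi2_hom: "X \<in> Obj A \<Longrightarrow> Y \<in> Obj A \<Longrightarrow>
          \<phi>2 X Y \<in> hom B (fobj R X \<odot>\<^bsub>B\<^esub> fobj R Y) (fobj R (X \<odot>\<^bsub>A\<^esub> Y))"
    and phi2_natural: "f \<in> hom A X X' \<Longrightarrow> g \<in> hom A Y Y' \<Longrightarrow>
          \<phi>2 X' Y' \<cdot>\<^bsub>B\<^esub> (farr R f \<otimes>\<^bsub>B\<^esub> farr R g) = farr R (f \<otimes>\<^bsub>A\<^esub> g) \<cdot>\<^bsub>B\<^esub> \<phi>2 X Y"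
    and phi0_hom: "\<phi>0 \<in> hom B (unit_obj B) (fobj R (unit_obj A))"
    and lax_assoc: "X \<in> Obj A \<Longrightarrow> Y \<in> Obj A \<Longrightarrow> Z \<in> Obj A \<Longrightarrow>
          farr R (assoc A X Y Z) \<cdot>\<^bsub>B\<^esub> \<phi>2 (X \<odot>\<^bsub>A\<^esub> Y) Z \<cdot>\<^bsub>B\<^esub> (\<phi>2 X Y \<otimes>\<^bsub>B\<^esub> ide B (fobj R Z))
          = \<phi>2 X (Y \<odot>\<^bsub>A\<^esub> Z) \<cdot>\<^bsub>B\<^esub> (ide B (fobj R X) \<otimes>\<^bsub>B\<^esub> \<phi>2 Y Z)
              \<cdot>\<^bsub>B\<^esub> assoc B (fobj R X) (fobj R Y) (fobj R Z)"
    and lax_lunit: "X \<in> Obj A \<Longrightarrow>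
          farr R (lunit A X) \<cdot>\<^bsub>B\<^esub> \<phi>2 (unit_obj A) X \<cdot>\<^bsub>B\<^esub> (\<phi>0 \<otimes>\<^bsub>B\<^esub> ide B (fobj R X))
          = lunit B (fobj R X)"
    and lax_runit: "X \<in> Obj A \<Longrightarrow>
          farr R (runit A X) \<cdot>\<^bsub>B\<^esub> \<phi>2 X (unit_obj A) \<cdot>\<^bsub>B\<^esub> (ide B (fobj R X) \<otimes>\<^bsub>B\<^esub> \<phi>0)
          = runit B (fobj R X)"

definition Alg_functor ::
  "('p, 'n, 'y) category_data_scheme \<Rightarrow> ('o, 'm, 'p, 'n) functor_data \<Rightarrow>
   ('o \<Rightarrow> 'o \<Rightarrow> 'n) \<Rightarrow> 'n \<Rightarrow>
   (('o, 'm) structured, ('o, 'm) structured_arr,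
    ('p, 'n) structured, ('p, 'n) structured_arr) functor_data" where
  "Alg_functor B R \<phi>2 \<phi>0 =
    (let F = (\<lambda>(A, m, u). (fobj R A, farr R m \<cdot>\<^bsub>B\<^esub> \<phi>2 A A, farr R u \<cdot>\<^bsub>B\<^esub> \<phi>0))
     in \<lparr> fobj = F, farr = (\<lambda>(S, T, f). (F S, F T, farr R f)) \<rparr>)"

definition Coalg_functor ::
  "('o, 'm, 'x) category_data_scheme \<Rightarrow> ('p, 'n, 'o, 'm) functor_data \<Rightarrow>
   ('p \<Rightarrow> 'p \<Rightarrow> 'm) \<Rightarrow> 'm \<Rightarrow>
   (('p, 'n) structured, ('p, 'n) structured_arr,
    ('o, 'm) structured, ('o, 'm) structured_arr) functor_data" where
  "Coalg_functor A L \<psi>2 \<psi>0 =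
    (let F = (\<lambda>(D, \<Delta>, e). (fobj L D, \<psi>2 D D \<cdot>\<^bsub>A\<^esub> farr L \<Delta>, \<psi>0 \<cdot>\<^bsub>A\<^esub> farr L e))
     in \<lparr> fobj = F, farr = (\<lambda>(S, T, f). (F S, F T, farr L f)) \<rparr>)"

text \<open>The colax monoidal structure on a left adjoint \<open>L : B \<rightarrow> A\<close> of \<open>R\<close> that is the mate of
  \<open>\<phi>2\<close>, \<open>\<phi>0\<close>.\<close>

definition colax2 ::
  "('o, 'm, 'x) monoidal_data_scheme \<Rightarrow> ('p, 'n, 'y) monoidal_data_scheme \<Rightarrow>
   ('p, 'n, 'o, 'm) functor_data \<Rightarrow> ('p \<Rightarrow> 'n) \<Rightarrow> ('o \<Rightarrow> 'm) \<Rightarrow>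
   ('o \<Rightarrow> 'o \<Rightarrow> 'n) \<Rightarrow> 'p \<Rightarrow> 'p \<Rightarrow> 'm" where
  "colax2 A B L \<eta> \<epsilon> \<phi>2 X Y =
     \<epsilon> (fobj L X \<odot>\<^bsub>A\<^esub> fobj L Y) \<cdot>\<^bsub>A\<^esub> farr L (\<phi>2 (fobj L X) (fobj L Y))
       \<cdot>\<^bsub>A\<^esub> farr L (\<eta> X \<otimes>\<^bsub>B\<^esub> \<eta> Y)"

definition colax0 ::
  "('o, 'm, 'x) monoidal_data_scheme \<Rightarrow> ('p, 'n, 'o, 'm) functor_data \<Rightarrow>
   ('o \<Rightarrow> 'm) \<Rightarrow> 'n \<Rightarrow> 'm" where
  "colax0 A L \<epsilon> \<phi>0 = \<epsilon> (unit_obj A) \<cdot>\<^bsub>A\<^esub> farr L \<phi>0"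

text \<open>\<open>L : B \<rightarrow> A\<close> and \<open>R : A \<rightarrow> B\<close> form a liftable pair of adjoint functors, with respect to the
  unit \<open>\<eta>\<close>, the counit \<open>\<epsilon>\<close> and the lax monoidal structure \<open>\<phi>2\<close>, \<open>\<phi>0\<close> of \<open>R\<close>.\<close>

definition liftable_pair ::
  "('o, 'm, 'x) monoidal_data_scheme \<Rightarrow> ('p, 'n, 'y) monoidal_data_scheme \<Rightarrow>
   ('p, 'n, 'o, 'm) functor_data \<Rightarrow> ('o, 'm, 'p, 'n) functor_data \<Rightarrow>
   ('p \<Rightarrow> 'n) \<Rightarrow> ('o \<Rightarrow> 'm) \<Rightarrow> ('o \<Rightarrow> 'o \<Rightarrow> 'n) \<Rightarrow> 'n \<Rightarrow> bool" where
  "liftable_pair A B L R \<eta> \<epsilon> \<phi>2 \<phi>0 \<longleftrightarrow>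
     lax_monoidal_functor A B R \<phi>2 \<phi>0 \<and>
     adjunction A B L R \<eta> \<epsilon> \<and>
     has_left_adjoint (Alg A) (Alg B) (Alg_functor B R \<phi>2 \<phi>0) \<and>
     has_right_adjoint (Coalg B) (Coalg A)
       (Coalg_functor A L (colax2 A B L \<eta> \<epsilon> \<phi>2) (colax0 A L \<epsilon> \<phi>0))"

section \<open>Pre-rigid categories\<close>

definition is_predual :: "('o, 'm, 'x) monoidal_data_scheme \<Rightarrow> 'o \<Rightarrow> 'o \<Rightarrow> 'm \<Rightarrow> bool" where
  "is_predual C X D e \<longleftrightarrow>
     D \<in> Obj C \<and> e \<in> hom C (D \<odot>\<^bsub>C\<^esub> X) (unit_obj C) \<and>
     (\<forall>T \<in> Obj C. bij_betw (\<lambda>u. e \<cdot>\<^bsub>C\<^esub> (u \<otimes>\<^bsub>C\<^esub> ide C X))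
                    (hom C T D) (hom C (T \<odot>\<^bsub>C\<^esub> X) (unit_obj C)))"

definition pre_rigid :: "('o, 'm, 'x) monoidal_data_scheme \<Rightarrow> bool" where
  "pre_rigid C \<longleftrightarrow> (\<forall>X \<in> Obj C. \<exists>D e. is_predual C X D e)"

text \<open>The functor \<open>(-)\<^sup>*\<close> depends on a choice \<open>d X\<close> of pre-duals, with evaluations \<open>ev X\<close>.
  Such a choice exists exactly when the category is pre-rigid.\<close>

definition predual_choice ::
  "('o, 'm, 'x) monoidal_data_scheme \<Rightarrow> ('o \<Rightarrow> 'o) \<Rightarrow> ('o \<Rightarrow> 'm) \<Rightarrow> bool" where
  "predual_choice C d ev \<longleftrightarrow> (\<forall>X \<in> Obj C. is_predual C X (d X) (ev X))"

lemma pre_rigid_iff_predual_choice: "pre_rigid C \<longleftrightarrow> (\<exists>d ev. predual_choice C d ev)"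
  unfolding pre_rigid_def predual_choice_def by metis

text \<open>\<open>dagger C d ev T X t\<close> is \<open>t\<^sup>\<dagger> : T \<rightarrow> X\<^sup>*\<close>, for \<open>t : T \<otimes> X \<rightarrow> I\<close>.\<close>

definition dagger ::
  "('o, 'm, 'x) monoidal_data_scheme \<Rightarrow> ('o \<Rightarrow> 'o) \<Rightarrow> ('o \<Rightarrow> 'm) \<Rightarrow> 'o \<Rightarrow> 'o \<Rightarrow> 'm \<Rightarrow> 'm" where
  "dagger C d ev T X t =
     the_inv_into (hom C T (d X)) (\<lambda>u. ev X \<cdot>\<^bsub>C\<^esub> (u \<otimes>\<^bsub>C\<^esub> ide C X)) t"

text \<open>Since the opposite category has the same objects and arrows, a functor and its opposite
  have the same underlying maps. Thus the following is both \<open>(-)\<^sup>* : C\<^sup>o\<^sup>p \<rightarrow> C\<close> and its opposite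
  \<open>(-)\<^sup>* : C \<rightarrow> C\<^sup>o\<^sup>p\<close>; for \<open>f : X \<rightarrow> Y\<close> in \<open>C\<close>, \<open>f\<^sup>* : Y\<^sup>* \<rightarrow> X\<^sup>*\<close> in \<open>C\<close>.\<close>

definition dual_functor ::
  "('o, 'm, 'x) monoidal_data_scheme \<Rightarrow> ('o \<Rightarrow> 'o) \<Rightarrow> ('o \<Rightarrow> 'm) \<Rightarrow>
   ('o, 'm, 'o, 'm) functor_data" where
  "dual_functor C d ev =
    \<lparr> fobj = d,
      farr = (\<lambda>f. let X = src C f; Y = trg C f in
                dagger C d ev (d Y) X (ev Y \<cdot>\<^bsub>C\<^esub> (ide C (d Y) \<otimes>\<^bsub>C\<^esub> f))) \<rparr>"

text \<open>\<open>X\<^sup>* \<otimes> (c\<^bsub>X,Y\<^sup>*\<^esub>)\<inverse> \<otimes> Y : (X\<^sup>* \<otimes> Y\<^sup>*) \<otimes> (X \<otimes> Y) \<rightarrow> (X\<^sup>* \<otimes> X) \<otimes> (Y\<^sup>* \<otimes> Y)\<close>, with the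
  associativity constraints made explicit.\<close>

definition dual_interchange ::
  "('o, 'm, 'x) braided_data_scheme \<Rightarrow> ('o \<Rightarrow> 'o) \<Rightarrow> 'o \<Rightarrow> 'o \<Rightarrow> 'm" where
  "dual_interchange C d X Y =
     inv_arr C (assoc C (d X) X (d Y \<odot>\<^bsub>C\<^esub> Y))
     \<cdot>\<^bsub>C\<^esub> (ide C (d X) \<otimes>\<^bsub>C\<^esub>
           (assoc C X (d Y) Y
            \<cdot>\<^bsub>C\<^esub> (inv_arr C (braid C X (d Y)) \<otimes>\<^bsub>C\<^esub> ide C Y)
            \<cdot>\<^bsub>C\<^esub> inv_arr C (assoc C (d Y) X Y)))
     \<cdot>\<^bsub>C\<^esub> assoc C (d X) (d Y) (X \<odot>\<^bsub>C\<^esub> Y)"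

definition dual_phi2 ::
  "('o, 'm, 'x) braided_data_scheme \<Rightarrow> ('o \<Rightarrow> 'o) \<Rightarrow> ('o \<Rightarrow> 'm) \<Rightarrow> 'o \<Rightarrow> 'o \<Rightarrow> 'm" where
  "dual_phi2 C d ev X Y =
     dagger C d ev (d X \<odot>\<^bsub>C\<^esub> d Y) (X \<odot>\<^bsub>C\<^esub> Y)
       (unit_mult C \<cdot>\<^bsub>C\<^esub> (ev X \<otimes>\<^bsub>C\<^esub> ev Y) \<cdot>\<^bsub>C\<^esub> dual_interchange C d X Y)"

definition dual_phi0 ::
  "('o, 'm, 'x) monoidal_data_scheme \<Rightarrow> ('o \<Rightarrow> 'o) \<Rightarrow> ('o \<Rightarrow> 'm) \<Rightarrow> 'm" where
  "dual_phi0 C d ev = dagger C d ev (unit_obj C) (unit_obj C) (unit_mult C)"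

definition dual_unit ::
  "('o, 'm, 'x) braided_data_scheme \<Rightarrow> ('o \<Rightarrow> 'o) \<Rightarrow> ('o \<Rightarrow> 'm) \<Rightarrow> 'o \<Rightarrow> 'm" where
  "dual_unit C d ev X = dagger C d ev X (d X) (ev X \<cdot>\<^bsub>C\<^esub> braid C X (d X))"

text \<open>As an arrow of \<open>C\<close>, the counit at \<open>X\<close> is \<open>j\<^sub>X : X \<rightarrow> X\<^sup>*\<^sup>*\<close>.\<close>

definition dual_counit ::
  "('o, 'm, 'x) braided_data_scheme \<Rightarrow> ('o \<Rightarrow> 'o) \<Rightarrow> ('o \<Rightarrow> 'm) \<Rightarrow> 'o \<Rightarrow> 'm" where
  "dual_counit C d ev X = dagger C d ev X (d X) (ev X \<cdot>\<^bsub>C\<^esub> inv_arr C (braid C (d X) X))"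

end

theory Submission
  imports Defs
begin

text \<open>
  Regarded as arrows of \<open>C\<close>, the colax constraints of \<open>L\<close> are \<open>\<psi>\<^sub>0 = \<phi>\<^sub>0\<close> and
  \<open>\<psi>\<^sub>2(X, Y) = (c\<^bsub>X,Y\<^esub>)\<^sup>* \<circ> \<phi>\<^sub>2(Y, X) \<circ> c\<^bsub>X*,Y*\<^esub>\<close>. Coalgebras in \<open>C\<close> are algebras in
  \<open>C\<^sup>o\<^sup>p\<close> and conversely, so the functor on coalgebras induced by \<open>L\<close> takes \<open>(D, \<Delta>, e)\<close> to
  \<open>(D, c \<circ> \<Delta>, e)\<close>, applies the functor on algebras induced by \<open>R\<close>, and passes to the opposite
  algebra. The first and last steps are anti-isomorphisms of categories, so a left adjoint of the
  functor on algebras turns into a right adjoint of the functor on coalgebras.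

  The coherence computations rest on one device: a pairing \<open>q : E \<otimes> Y \<rightarrow> I\<close> slides past \<open>X\<close> to give
  \<open>E \<otimes> (X \<otimes> Y) \<rightarrow> X\<close>, and the product of two pairings used to define \<open>\<phi>\<^sub>2\<close> is a nested
  composite of such slides.
\<close>

section \<open>Isomorphisms and coherence\<close>

text \<open>The obstacle is that the braiding c need not be symmetric. The unit is built from c and
  the counit from its inverse, as the triangle identities require. The mate of
  \<open>\<phi>2\<close> along them is therefore not \<open>\<phi>2\<close> itself, and the functor
  on coalgebras is not just the functor on algebras read in the opposite categories. The two
  braidings left over in the mate are what saves the comparison: they are the twists of two passages
  to an opposite algebra, one before dualizing and one after. As c need not be an involution, such a
  passage is undone by the reversed braiding, not by c again. Since \<open>\<phi>2\<close> is also
  built from the inverse of c, products of pairings are studied for an arbitrary braiding and then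
  used in the category with the reversed one. Pre-duals come without coevaluations, so the only test
  for equality of arrows into a pre-dual is composition with \<open>ev\<close>; it turns every law
  of the duality functor into an equation between arrows into the unit object.\<close>

lemma in_hom_iff: "f \<in> hom C X Y \<longleftrightarrow> f \<in> Arr C \<and> src C f = X \<and> trg C f = Y"
  by (simp add: hom_def)

section \<open>Arrows and isomorphisms in a category\<close>

context category
begin

lemma src_mem [simp]: "f \<in> Arr C \<Longrightarrow> src C f \<in> Obj C"
  and trg_mem [simp]: "f \<in> Arr C \<Longrightarrow> trg C f \<in> Obj C"
  by (simp_all add: src_Obj trg_Obj)

lemma ide_simps [simp]:
  assumes "X \<in> Obj C"
  shows "ide C X \<in> Arr C" "src C (ide C X) = X" "trg C (ide C X) = X"
  using ide_hom[OF assms] by (simp_all add: in_hom_iff)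

lemma cmp_simps [simp]:
  assumes "f \<in> Arr C" "g \<in> Arr C" "src C g = trg C f"
  shows "g \<cdot> f \<in> Arr C" "src C (g \<cdot> f) = src C f" "trg C (g \<cdot> f) = trg C g"
  using cmp_hom[of f "src C f" "trg C f" g "trg C g"] assms by (simp_all add: in_hom_iff)

lemma cmp_assoc_simp [simp]:
  assumes "f \<in> Arr C" "g \<in> Arr C" "h \<in> Arr C" "src C g = trg C f" "src C h = trg C g"
  shows "(h \<cdot> g) \<cdot> f = h \<cdot> (g \<cdot> f)"
  using cmp_assoc[of f "src C f" "trg C f" g "trg C g" h "trg C h"] assms by (simp add: in_hom_iff)

lemma cmp_ide_simps [simp]:
  "f \<in> Arr C \<Longrightarrow> src C f = X \<Longrightarrow> f \<cdot> ide C X = f"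
  "f \<in> Arr C \<Longrightarrow> trg C f = X \<Longrightarrow> ide C X \<cdot> f = f"
  using cmp_ide_right cmp_ide_left by (auto simp: in_hom_iff)

text \<open>Composites are kept associated to the right, where an equation about
  \<open>g \<cdot> f\<close> matches only at the innermost end. Through this rule it also rewrites
  the middle of a composite.\<close>

lemma cmp_extend:
  assumes "g \<cdot> f = h" "f \<in> Arr C" "g \<in> Arr C" "k \<in> Arr C" "src C g = trg C f" "src C f = trg C k"
  shows "g \<cdot> (f \<cdot> k) = h \<cdot> k"
  using assms cmp_assoc_simp[of k f g] by simp

lemma inverse_arrows_unique:
  assumes "inverse_arrows C f g" "inverse_arrows C f h"
  shows "g = h"
proof -
  have *: "f \<in> Arr C" "g \<in> Arr C" "src C g = trg C f" "trg C g = src C f" "g \<cdot> f = ide C (src C f)"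
    "f \<in> Arr C" "h \<in> Arr C" "src C h = trg C f" "trg C h = src C f" "f \<cdot> h = ide C (trg C f)"
    using assms by (auto simp: inverse_arrows_def in_hom_iff)
  have "g = g \<cdot> (f \<cdot> h)" using * by simp
  also have "\<dots> = h" using * by (subst cmp_assoc_simp[symmetric]) auto
  finally show ?thesis .
qed

lemma inv_arr_eqI: "inverse_arrows C f g \<Longrightarrow> inv_arr C f = g"
  unfolding inv_arr_def by (rule the_equality) (auto intro: inverse_arrows_unique)

lemma iso_simps [simp]:
  assumes "iso C f"
  shows "f \<in> Arr C" "inv_arr C f \<in> Arr C" "src C (inv_arr C f) = trg C f"
    "trg C (inv_arr C f) = src C f" "inv_arr C f \<cdot> f = ide C (src C f)"
    "f \<cdot> inv_arr C f = ide C (trg C f)"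
  using assms inv_arr_eqI unfolding iso_def by (auto simp: inverse_arrows_def in_hom_iff)

lemma iso_cancel_simps [simp]:
  assumes "iso C f" "k \<in> Arr C"
  shows "trg C k = src C f \<Longrightarrow> inv_arr C f \<cdot> (f \<cdot> k) = k"
    "trg C k = trg C f \<Longrightarrow> f \<cdot> (inv_arr C f \<cdot> k) = k"
  using assms cmp_extend[OF iso_simps(5)[OF assms(1)], of k]
    cmp_extend[OF iso_simps(6)[OF assms(1)], of k] by simp_all

lemma inverse_arrowsI:
  assumes "f \<in> Arr C" "g \<in> Arr C" "src C g = trg C f" "trg C g = src C f"
    "g \<cdot> f = ide C (src C f)" "f \<cdot> g = ide C (trg C f)"
  shows "iso C f" "inv_arr C f = g"
proof -
  have "inverse_arrows C f g" using assms by (simp add: inverse_arrows_def in_hom_iff)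
  then show "iso C f" "inv_arr C f = g" by (auto simp: iso_def inv_arr_eqI)
qed

lemma iso_ide [simp]: "X \<in> Obj C \<Longrightarrow> iso C (ide C X)"
  and inv_ide [simp]: "X \<in> Obj C \<Longrightarrow> inv_arr C (ide C X) = ide C X"
  using inverse_arrowsI[of "ide C X" "ide C X"] by auto

lemma iso_inv [simp]: "iso C f \<Longrightarrow> iso C (inv_arr C f)"
  and inv_inv [simp]: "iso C f \<Longrightarrow> inv_arr C (inv_arr C f) = f"
  using inverse_arrowsI[of "inv_arr C f" f] by auto

lemma iso_cmp [simp]: "iso C f \<Longrightarrow> iso C g \<Longrightarrow> src C g = trg C f \<Longrightarrow> iso C (g \<cdot> f)"
  and inv_cmp [simp]: "iso C f \<Longrightarrow> iso C g \<Longrightarrow> src C g = trg C f \<Longrightarrow>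
    inv_arr C (g \<cdot> f) = inv_arr C f \<cdot> inv_arr C g"
  using inverse_arrowsI[of "g \<cdot> f" "inv_arr C f \<cdot> inv_arr C g"] by auto

lemma iso_monic:
  assumes "iso C f" "f \<cdot> g = f \<cdot> h" "g \<in> Arr C" "h \<in> Arr C" "trg C g = src C f" "trg C h = src C f"
  shows "g = h"
proof -
  have "inv_arr C f \<cdot> (f \<cdot> g) = inv_arr C f \<cdot> (f \<cdot> h)" using assms by simp
  then show ?thesis using assms(1,3-) by simp
qed

lemma iso_epic:
  assumes "iso C f" "g \<cdot> f = h \<cdot> f" "g \<in> Arr C" "h \<in> Arr C" "src C g = trg C f" "src C h = trg C f"
  shows "g = h"
proof -
  have "(g \<cdot> f) \<cdot> inv_arr C f = (h \<cdot> f) \<cdot> inv_arr C f" using assms by simp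
  then show ?thesis using assms(1,3-) by simp
qed

text \<open>Carries naturality from the constraints and the braiding to their inverses, hence to the
  opposite and the reversed structures.\<close>

lemma inv_square:
  assumes "iso C a" "iso C b" "b \<cdot> f = g \<cdot> a" "f \<in> Arr C" "g \<in> Arr C"
    and "src C f = src C a" "trg C f = src C b" "src C g = trg C a" "trg C g = trg C b"
  shows "inv_arr C b \<cdot> g = f \<cdot> inv_arr C a"
proof -
  have "inv_arr C b \<cdot> ((g \<cdot> a) \<cdot> inv_arr C a) = inv_arr C b \<cdot> ((b \<cdot> f) \<cdot> inv_arr C a)"
    by (simp only: assms(3))
  then show ?thesis
    using assms(1,2,4-) by simp
qed

lemma inv_move_left:
  assumes "iso C a" "f \<in> Arr C" "g \<in> Arr C" "trg C f = src C a" "trg C g = trg C a"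
  shows "f = inv_arr C a \<cdot> g \<longleftrightarrow> a \<cdot> f = g"
  using assms by auto

lemma inv_move_right:
  assumes "iso C a" "f \<in> Arr C" "g \<in> Arr C" "src C f = src C a" "src C g = trg C a"
  shows "f \<cdot> inv_arr C a = g \<longleftrightarrow> f = g \<cdot> a"
  using assms by auto

end

section \<open>Whiskering, the pentagon and unit coherence\<close>

context monoidal_category
begin

lemma tens_Obj_simp [simp]: "X \<in> Obj C \<Longrightarrow> Y \<in> Obj C \<Longrightarrow> X \<odot> Y \<in> Obj C"
  by (rule tens_Obj)

lemma unit_Obj_simp [simp]: "unit_obj C \<in> Obj C"
  by (rule unit_Obj)

lemma tens_simps [simp]:
  assumes "f \<in> Arr C" "g \<in> Arr C"
  shows "f \<otimes> g \<in> Arr C" "src C (f \<otimes> g) = src C f \<odot> src C g" "trg C (f \<otimes> g) = trg C f \<odot> trg C g"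
  using tens_hom[of f "src C f" "trg C f" g "src C g" "trg C g"] assms by (simp_all add: in_hom_iff)

lemma tens_ide_simp [simp]: "X \<in> Obj C \<Longrightarrow> Y \<in> Obj C \<Longrightarrow> ide C X \<otimes> ide C Y = ide C (X \<odot> Y)"
  by (rule tens_ide)

lemma interchange [simp]:
  assumes "f \<in> Arr C" "g \<in> Arr C" "f' \<in> Arr C" "g' \<in> Arr C" "src C f' = trg C f" "src C g' = trg C g"
  shows "(f' \<otimes> g') \<cdot> (f \<otimes> g) = (f' \<cdot> f) \<otimes> (g' \<cdot> g)"
  using tens_cmp[of f "src C f" "trg C f" f' "trg C f'" g "src C g" "trg C g" g' "trg C g'"] assms
  by (simp add: in_hom_iff)

lemma interchange_extended [simp]:
  assumes "f \<in> Arr C" "g \<in> Arr C" "f' \<in> Arr C" "g' \<in> Arr C" "src C f' = trg C f" "src C g' = trg C g"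
    and "k \<in> Arr C" "trg C k = src C f \<odot> src C g"
  shows "(f' \<otimes> g') \<cdot> ((f \<otimes> g) \<cdot> k) = ((f' \<cdot> f) \<otimes> (g' \<cdot> g)) \<cdot> k"
  using assms by (intro cmp_extend) auto

lemma iso_tens [simp]: "iso C f \<Longrightarrow> iso C g \<Longrightarrow> iso C (f \<otimes> g)"
  and inv_tens [simp]: "iso C f \<Longrightarrow> iso C g \<Longrightarrow> inv_arr C (f \<otimes> g) = inv_arr C f \<otimes> inv_arr C g"
  using inverse_arrowsI[of "f \<otimes> g" "inv_arr C f \<otimes> inv_arr C g"] by auto

lemma assoc_simps [simp]:
  assumes "X \<in> Obj C" "Y \<in> Obj C" "Z \<in> Obj C"
  shows "iso C (assoc C X Y Z)" "src C (assoc C X Y Z) = (X \<odot> Y) \<odot> Z" "trg C (assoc C X Y Z) = X \<odot> (Y \<odot> Z)"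
  using assoc_iso[OF assms] assoc_hom[OF assms] by (simp_all add: in_hom_iff)

lemma unit_simps [simp]:
  assumes "X \<in> Obj C"
  shows "iso C (lunit C X)" "src C (lunit C X) = unit_obj C \<odot> X" "trg C (lunit C X) = X"
    "iso C (runit C X)" "src C (runit C X) = X \<odot> unit_obj C" "trg C (runit C X) = X"
  using lunit_iso[OF assms] lunit_hom[OF assms] runit_iso[OF assms] runit_hom[OF assms]
  by (simp_all add: in_hom_iff)

lemma assoc_nat:
  assumes "f \<in> Arr C" "g \<in> Arr C" "h \<in> Arr C"
  shows "assoc C (trg C f) (trg C g) (trg C h) \<cdot> ((f \<otimes> g) \<otimes> h)
    = (f \<otimes> (g \<otimes> h)) \<cdot> assoc C (src C f) (src C g) (src C h)"
  using assoc_natural[of f "src C f" "trg C f" g "src C g" "trg C g" h "src C h" "trg C h"] assms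
  by (simp add: in_hom_iff)

lemma inv_assoc_nat:
  assumes "f \<in> Arr C" "g \<in> Arr C" "h \<in> Arr C"
  shows "inv_arr C (assoc C (trg C f) (trg C g) (trg C h)) \<cdot> (f \<otimes> (g \<otimes> h))
    = ((f \<otimes> g) \<otimes> h) \<cdot> inv_arr C (assoc C (src C f) (src C g) (src C h))"
  by (rule inv_square[OF _ _ assoc_nat[OF assms]]) (use assms in simp_all)

lemma lunit_nat:
  assumes "f \<in> Arr C"
  shows "lunit C (trg C f) \<cdot> (ide C (unit_obj C) \<otimes> f) = f \<cdot> lunit C (src C f)"
  using lunit_natural[of f] assms by (simp add: in_hom_iff)

lemma runit_nat:
  assumes "f \<in> Arr C"
  shows "runit C (trg C f) \<cdot> (f \<otimes> ide C (unit_obj C)) = f \<cdot> runit C (src C f)"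
  using runit_natural[of f] assms by (simp add: in_hom_iff)

lemma whisker_left:
  assumes "X \<in> Obj C" "f \<in> Arr C" "g \<in> Arr C" "src C g = trg C f"
  shows "ide C X \<otimes> (g \<cdot> f) = (ide C X \<otimes> g) \<cdot> (ide C X \<otimes> f)"
  using assms by simp

lemma whisker_right:
  assumes "X \<in> Obj C" "f \<in> Arr C" "g \<in> Arr C" "src C g = trg C f"
  shows "(g \<cdot> f) \<otimes> ide C X = (g \<otimes> ide C X) \<cdot> (f \<otimes> ide C X)"
  using assms by simp

lemma whisker_cancel [simp]:
  assumes "iso C f" "X \<in> Obj C"
  shows "(ide C X \<otimes> inv_arr C f) \<cdot> (ide C X \<otimes> f) = ide C (X \<odot> src C f)"
    "(ide C X \<otimes> f) \<cdot> (ide C X \<otimes> inv_arr C f) = ide C (X \<odot> trg C f)"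
    "(inv_arr C f \<otimes> ide C X) \<cdot> (f \<otimes> ide C X) = ide C (src C f \<odot> X)"
    "(f \<otimes> ide C X) \<cdot> (inv_arr C f \<otimes> ide C X) = ide C (trg C f \<odot> X)"
  using assms by simp_all

lemma whisker_cancel_extended [simp]:
  assumes "iso C f" "X \<in> Obj C" "k \<in> Arr C"
  shows "trg C k = X \<odot> src C f \<Longrightarrow> (ide C X \<otimes> inv_arr C f) \<cdot> ((ide C X \<otimes> f) \<cdot> k) = k"
    "trg C k = X \<odot> trg C f \<Longrightarrow> (ide C X \<otimes> f) \<cdot> ((ide C X \<otimes> inv_arr C f) \<cdot> k) = k"
    "trg C k = src C f \<odot> X \<Longrightarrow> (inv_arr C f \<otimes> ide C X) \<cdot> ((f \<otimes> ide C X) \<cdot> k) = k"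
    "trg C k = trg C f \<odot> X \<Longrightarrow> (f \<otimes> ide C X) \<cdot> ((inv_arr C f \<otimes> ide C X) \<cdot> k) = k"
  using assms by simp_all

text \<open>
  Composites of tensor products have two normal forms: \<open>merge\<close> (the simpset's default) pushes composition
  inside \<open>\<otimes>\<close>; \<open>expand\<close> with \<open>merge\<close> deleted splits everything into whiskered generators, to which
  the pentagon and naturality laws apply.
\<close>

lemmas expand = whisker_left whisker_right
lemmas merge = interchange interchange_extended

lemma pentagon_simp:
  assumes "W \<in> Obj C" "X \<in> Obj C" "Y \<in> Obj C" "Z \<in> Obj C"
  shows "(ide C W \<otimes> assoc C X Y Z) \<cdot> (assoc C W (X \<odot> Y) Z \<cdot> (assoc C W X Y \<otimes> ide C Z))
    = assoc C W X (Y \<odot> Z) \<cdot> assoc C (W \<odot> X) Y Z"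
  using pentagon[OF assms] assms by (simp del: merge)

text \<open>The pentagon oriented for rewriting: here and in \<open>pentagon_right\<close>, an
  associator or inverse associator whiskered on the right is traded for ones that are bare or
  whiskered on the left.\<close>

lemma pentagon_left:
  assumes "W \<in> Obj C" "X \<in> Obj C" "Y \<in> Obj C" "Z \<in> Obj C"
  shows "assoc C W (X \<odot> Y) Z \<cdot> (assoc C W X Y \<otimes> ide C Z)
    = (ide C W \<otimes> inv_arr C (assoc C X Y Z)) \<cdot> (assoc C W X (Y \<odot> Z) \<cdot> assoc C (W \<odot> X) Y Z)"
  using assms by (simp add: pentagon_simp[symmetric] del: merge)

lemma pentagon_right:
  assumes "W \<in> Obj C" "X \<in> Obj C" "Y \<in> Obj C" "Z \<in> Obj C"
  shows "assoc C (W \<odot> X) Y Z \<cdot> (inv_arr C (assoc C W X Y) \<otimes> ide C Z)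
    = inv_arr C (assoc C W X (Y \<odot> Z)) \<cdot> ((ide C W \<otimes> assoc C X Y Z) \<cdot> assoc C W (X \<odot> Y) Z)"
proof -
  have "inv_arr C (assoc C W X (Y \<odot> Z)) \<cdot> ((ide C W \<otimes> assoc C X Y Z) \<cdot> assoc C W (X \<odot> Y) Z)
    = inv_arr C (assoc C W X (Y \<odot> Z)) \<cdot> (((ide C W \<otimes> assoc C X Y Z) \<cdot> (assoc C W (X \<odot> Y) Z
       \<cdot> (assoc C W X Y \<otimes> ide C Z))) \<cdot> (inv_arr C (assoc C W X Y) \<otimes> ide C Z))"
    using assms by (simp del: merge)
  then show ?thesis
    unfolding pentagon_simp[OF assms] using assms by (simp del: merge)
qed

lemma assoc_nat_outer:
  assumes "A \<in> Obj C" "B \<in> Obj C" "h \<in> Arr C" "trg C h = D"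
  shows "assoc C A B D \<cdot> (ide C (A \<odot> B) \<otimes> h) = (ide C A \<otimes> (ide C B \<otimes> h)) \<cdot> assoc C A B (src C h)"
  using assoc_nat[of "ide C A" "ide C B" h] assms by simp

lemma assoc_nat_inner:
  assumes "A \<in> Obj C" "B \<in> Obj C" "h \<in> Arr C" "trg C h = D"
  shows "assoc C D A B \<cdot> ((h \<otimes> ide C A) \<otimes> ide C B) = (h \<otimes> ide C (A \<odot> B)) \<cdot> assoc C (src C h) A B"
  using assoc_nat[of h "ide C A" "ide C B"] assms by simp

lemma assoc_nat_middle:
  assumes "A \<in> Obj C" "B \<in> Obj C" "h \<in> Arr C" "trg C h = D"
  shows "assoc C A D B \<cdot> ((ide C A \<otimes> h) \<otimes> ide C B) = (ide C A \<otimes> (h \<otimes> ide C B)) \<cdot> assoc C A (src C h) B"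
  using assoc_nat[of "ide C A" h "ide C B"] assms by simp

lemma triangle_simp:
  assumes "X \<in> Obj C" "Y \<in> Obj C"
  shows "(ide C X \<otimes> lunit C Y) \<cdot> assoc C X (unit_obj C) Y = runit C X \<otimes> ide C Y"
  using triangle assms .

text \<open>Naturality of \<open>lunit\<close> makes tensoring with the unit object isomorphic to
  the identity functor, hence faithful. Unit coherence may thus be proved after adding a unit
  factor, which gives the triangle something to act on.\<close>

lemma tens_unit_left_inj:
  assumes "ide C (unit_obj C) \<otimes> f = ide C (unit_obj C) \<otimes> g"
    and "f \<in> Arr C" "g \<in> Arr C" "src C f = src C g" "trg C f = trg C g"
  shows "f = g"
proof (rule iso_epic[of "lunit C (src C f)"])
  show "f \<cdot> lunit C (src C f) = g \<cdot> lunit C (src C f)"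
    using lunit_nat[of f] lunit_nat[of g] assms by simp
qed (use assms in simp_all)

lemma tens_unit_right_inj:
  assumes "f \<otimes> ide C (unit_obj C) = g \<otimes> ide C (unit_obj C)"
    and "f \<in> Arr C" "g \<in> Arr C" "src C f = src C g" "trg C f = trg C g"
  shows "f = g"
proof (rule iso_epic[of "runit C (src C f)"])
  show "f \<cdot> runit C (src C f) = g \<cdot> runit C (src C f)"
    using runit_nat[of f] runit_nat[of g] assms by simp
qed (use assms in simp_all)

text \<open>Kelly's argument: after tensoring with the unit object, the pentagon and two triangles suffice.\<close>

lemma lunit_tensor:
  assumes "X \<in> Obj C" "Y \<in> Obj C"
  shows "lunit C (X \<odot> Y) \<cdot> assoc C (unit_obj C) X Y = lunit C X \<otimes> ide C Y"
proof (rule tens_unit_left_inj)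
  let ?I = "unit_obj C"
  let ?k = "assoc C ?I (?I \<odot> X) Y \<cdot> (assoc C ?I ?I X \<otimes> ide C Y)"
  have "(ide C ?I \<otimes> (lunit C (X \<odot> Y) \<cdot> assoc C ?I X Y)) \<cdot> ?k
      = ((ide C ?I \<otimes> lunit C (X \<odot> Y)) \<cdot> assoc C ?I ?I (X \<odot> Y)) \<cdot> assoc C (?I \<odot> ?I) X Y"
    using assms by (simp add: expand pentagon_simp del: merge)
  also have "\<dots> = (runit C ?I \<otimes> ide C (X \<odot> Y)) \<cdot> assoc C (?I \<odot> ?I) X Y"
    using assms by (simp only: triangle_simp tens_Obj unit_Obj)
  also have "\<dots> = assoc C ?I X Y \<cdot> ((runit C ?I \<otimes> ide C X) \<otimes> ide C Y)"
    using assms by (simp add: assoc_nat_inner)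
  also have "\<dots> = assoc C ?I X Y \<cdot> (((ide C ?I \<otimes> lunit C X) \<cdot> assoc C ?I ?I X) \<otimes> ide C Y)"
    using assms by (simp only: triangle_simp unit_Obj)
  also have "\<dots> = (ide C ?I \<otimes> (lunit C X \<otimes> ide C Y)) \<cdot> ?k"
    using assms by (simp add: expand cmp_extend[OF assoc_nat_middle] del: merge)
  finally have *: "(ide C ?I \<otimes> (lunit C (X \<odot> Y) \<cdot> assoc C ?I X Y)) \<cdot> ?k
      = (ide C ?I \<otimes> (lunit C X \<otimes> ide C Y)) \<cdot> ?k" .
  show "ide C ?I \<otimes> (lunit C (X \<odot> Y) \<cdot> assoc C ?I X Y) = ide C ?I \<otimes> (lunit C X \<otimes> ide C Y)"
    by (rule iso_epic[OF _ *]) (use assms in simp_all)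
qed (use assms in simp_all)

text \<open>The mirror image of the argument for \<open>lunit_tensor\<close>, with the extra unit
  factor on the right.\<close>

lemma runit_tensor:
  assumes "X \<in> Obj C" "Y \<in> Obj C"
  shows "(ide C X \<otimes> runit C Y) \<cdot> assoc C X Y (unit_obj C) = runit C (X \<odot> Y)"
proof (rule tens_unit_right_inj)
  let ?I = "unit_obj C"
  have "assoc C X Y ?I \<cdot> (((ide C X \<otimes> runit C Y) \<cdot> assoc C X Y ?I) \<otimes> ide C ?I)
      = (ide C X \<otimes> (runit C Y \<otimes> ide C ?I)) \<cdot> (assoc C X (Y \<odot> ?I) ?I \<cdot> (assoc C X Y ?I \<otimes> ide C ?I))"
    using assms by (simp add: expand cmp_extend[OF assoc_nat_middle] del: merge)
  also have "\<dots> = (ide C X \<otimes> ((ide C Y \<otimes> lunit C ?I) \<cdot> assoc C Y ?I ?I))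
      \<cdot> (assoc C X (Y \<odot> ?I) ?I \<cdot> (assoc C X Y ?I \<otimes> ide C ?I))"
    using assms by (simp only: triangle_simp unit_Obj)
  also have "\<dots> = (ide C X \<otimes> (ide C Y \<otimes> lunit C ?I)) \<cdot> (assoc C X Y (?I \<odot> ?I) \<cdot> assoc C (X \<odot> Y) ?I ?I)"
    using assms by (simp add: expand pentagon_simp del: merge)
  also have "\<dots> = assoc C X Y ?I \<cdot> ((ide C (X \<odot> Y) \<otimes> lunit C ?I) \<cdot> assoc C (X \<odot> Y) ?I ?I)"
    using assms by (simp add: cmp_extend[OF assoc_nat_outer] del: merge)
  also have "\<dots> = assoc C X Y ?I \<cdot> (runit C (X \<odot> Y) \<otimes> ide C ?I)"
    using assms by (simp only: triangle_simp unit_Obj tens_Obj)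
  finally have *: "assoc C X Y ?I \<cdot> (((ide C X \<otimes> runit C Y) \<cdot> assoc C X Y ?I) \<otimes> ide C ?I)
      = assoc C X Y ?I \<cdot> (runit C (X \<odot> Y) \<otimes> ide C ?I)" .
  show "((ide C X \<otimes> runit C Y) \<cdot> assoc C X Y ?I) \<otimes> ide C ?I = runit C (X \<odot> Y) \<otimes> ide C ?I"
    by (rule iso_monic[OF _ *]) (use assms in simp_all)
qed (use assms in simp_all)

text \<open>Naturality of \<open>lunit\<close> at \<open>lunit C ?I\<close> itself identifies the
  constraint at \<open>?I \<odot> ?I\<close>. Then \<open>lunit_tensor\<close> and the triangle
  compute the same composite in two ways.\<close>

lemma lunit_unit_obj: "lunit C (unit_obj C) = runit C (unit_obj C)"
proof (rule tens_unit_right_inj)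
  let ?I = "unit_obj C"
  have "lunit C (?I \<odot> ?I) = ide C ?I \<otimes> lunit C ?I"
    by (rule iso_monic[of "lunit C ?I"]) (use lunit_nat[of "lunit C ?I"] in simp_all)
  then have "lunit C ?I \<otimes> ide C ?I = (ide C ?I \<otimes> lunit C ?I) \<cdot> assoc C ?I ?I ?I"
    by (simp add: lunit_tensor[symmetric])
  then show "lunit C ?I \<otimes> ide C ?I = runit C ?I \<otimes> ide C ?I"
    by (simp only: triangle_simp unit_Obj)
qed simp_all

text \<open>The exchange \<open>f\<close> is arbitrary: what rests on associativity alone is settled
  before any braiding appears, and then serves the braiding, its inverse and the composites in the
  hexagons.\<close>

definition swap :: "'o \<Rightarrow> 'o \<Rightarrow> 'o \<Rightarrow> 'm \<Rightarrow> 'm" where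
  "swap E X T f = assoc C X E T \<cdot> ((f \<otimes> ide C T) \<cdot> inv_arr C (assoc C E X T))"

text \<open>The interchange of the two inner factors of
  \<open>(D \<odot> E) \<odot> (X \<odot> Y)\<close>. With the inverse braiding for \<open>f\<close>
  it is the \<open>dual_interchange\<close> behind \<open>\<phi>2\<close>.\<close>

definition middle :: "'o \<Rightarrow> 'o \<Rightarrow> 'o \<Rightarrow> 'o \<Rightarrow> 'm \<Rightarrow> 'm" where
  "middle D E X Y f = inv_arr C (assoc C D X (E \<odot> Y)) \<cdot>
     ((ide C D \<otimes> swap E X Y f) \<cdot> assoc C D E (X \<odot> Y))"

lemma swap_simps [simp]:
  assumes "E \<in> Obj C" "X \<in> Obj C" "T \<in> Obj C" "f \<in> Arr C" "src C f = E \<odot> X" "trg C f = X \<odot> E"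
  shows "swap E X T f \<in> Arr C" "src C (swap E X T f) = E \<odot> (X \<odot> T)"
    "trg C (swap E X T f) = X \<odot> (E \<odot> T)"
  using assms by (simp_all add: swap_def)

lemma middle_simps [simp]:
  assumes "D \<in> Obj C" "E \<in> Obj C" "X \<in> Obj C" "Y \<in> Obj C"
    "f \<in> Arr C" "src C f = E \<odot> X" "trg C f = X \<odot> E"
  shows "middle D E X Y f \<in> Arr C" "src C (middle D E X Y f) = (D \<odot> E) \<odot> (X \<odot> Y)"
    "trg C (middle D E X Y f) = (D \<odot> X) \<odot> (E \<odot> Y)"
  using assms by (simp_all add: middle_def)

text \<open>The third exchange is the hexagon composite of \<open>a\<close> and \<open>b\<close>, so
  for braidings this says that a product moves past \<open>D\<close> one factor at a time. Pentagon
  and naturality of the associator are all it takes.\<close>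

lemma swap_tensor_left:
  assumes "A \<in> Obj C" "B \<in> Obj C" "D \<in> Obj C" "T \<in> Obj C"
    and "a \<in> Arr C" "src C a = A \<odot> D" "trg C a = D \<odot> A"
    and "b \<in> Arr C" "src C b = B \<odot> D" "trg C b = D \<odot> B"
  shows "swap (A \<odot> B) D T (swap A D B a \<cdot> ((ide C A \<otimes> b) \<cdot> assoc C A B D))
    = (ide C D \<otimes> inv_arr C (assoc C A B T)) \<cdot> (swap A D (B \<odot> T) a \<cdot>
        ((ide C A \<otimes> swap B D T b) \<cdot> assoc C A B (D \<odot> T)))"
  using assms
  apply (simp add: swap_def expand pentagon_left pentagon_right
     cmp_extend[OF pentagon_left] cmp_extend[OF pentagon_right]
     cmp_extend[OF assoc_nat_inner] cmp_extend[OF assoc_nat_middle] del: merge)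
  done

lemma swap_tensor_right:
  assumes "F \<in> Obj C" "X \<in> Obj C" "Y \<in> Obj C" "T \<in> Obj C"
    and "a \<in> Arr C" "src C a = F \<odot> X" "trg C a = X \<odot> F"
    and "b \<in> Arr C" "src C b = F \<odot> Y" "trg C b = Y \<odot> F"
  shows "swap F (X \<odot> Y) T (inv_arr C (assoc C X Y F) \<cdot> ((ide C X \<otimes> b) \<cdot> swap F X Y a))
    = inv_arr C (assoc C X Y (F \<odot> T)) \<cdot> ((ide C X \<otimes> swap F Y T b) \<cdot>
        (swap F X (Y \<odot> T) a \<cdot> (ide C F \<otimes> assoc C X Y T)))"
  using assms
  apply (simp add: swap_def expand pentagon_left pentagon_right
     cmp_extend[OF pentagon_left] cmp_extend[OF pentagon_right]
     cmp_extend[OF assoc_nat_inner] cmp_extend[OF assoc_nat_middle] del: merge)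
  done

lemma swap_nat:
  assumes "e \<in> Arr C" "x \<in> Arr C" "t \<in> Arr C" "f \<in> Arr C" "f' \<in> Arr C"
    and "src C f = src C e \<odot> src C x" "trg C f = src C x \<odot> src C e"
    and "src C f' = trg C e \<odot> trg C x" "trg C f' = trg C x \<odot> trg C e"
    and nat: "f' \<cdot> (e \<otimes> x) = (x \<otimes> e) \<cdot> f"
  shows "swap (trg C e) (trg C x) (trg C t) f' \<cdot> (e \<otimes> (x \<otimes> t))
    = (x \<otimes> (e \<otimes> t)) \<cdot> swap (src C e) (src C x) (src C t) f"
proof -
  have "swap (trg C e) (trg C x) (trg C t) f' \<cdot> (e \<otimes> (x \<otimes> t))
    = assoc C (trg C x) (trg C e) (trg C t) \<cdot> (((f' \<cdot> (e \<otimes> x)) \<otimes> t)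
       \<cdot> inv_arr C (assoc C (src C e) (src C x) (src C t)))"
    using assms(1-9) by (simp add: swap_def inv_assoc_nat)
  also have "\<dots> = assoc C (trg C x) (trg C e) (trg C t) \<cdot> (((x \<otimes> e) \<otimes> t)
       \<cdot> ((f \<otimes> ide C (src C t)) \<cdot> inv_arr C (assoc C (src C e) (src C x) (src C t))))"
    using assms(1-9) by (simp add: nat)
  also have "\<dots> = (x \<otimes> (e \<otimes> t)) \<cdot> swap (src C e) (src C x) (src C t) f"
    using assms(1-9) by (simp add: swap_def cmp_extend[OF assoc_nat] del: merge)
  finally show ?thesis .
qed

lemma middle_nat:
  assumes "k \<in> Arr C" "e \<in> Arr C" "x \<in> Arr C" "t \<in> Arr C" "f \<in> Arr C" "f' \<in> Arr C"
    and "src C f = src C e \<odot> src C x" "trg C f = src C x \<odot> src C e"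
    and "src C f' = trg C e \<odot> trg C x" "trg C f' = trg C x \<odot> trg C e"
    and nat: "f' \<cdot> (e \<otimes> x) = (x \<otimes> e) \<cdot> f"
  shows "middle (trg C k) (trg C e) (trg C x) (trg C t) f' \<cdot> ((k \<otimes> e) \<otimes> (x \<otimes> t))
    = ((k \<otimes> x) \<otimes> (e \<otimes> t)) \<cdot> middle (src C k) (src C e) (src C x) (src C t) f"
proof -
  note s = swap_nat[OF assms(2-)]
  have "middle (trg C k) (trg C e) (trg C x) (trg C t) f' \<cdot> ((k \<otimes> e) \<otimes> (x \<otimes> t))
    = inv_arr C (assoc C (trg C k) (trg C x) (trg C e \<odot> trg C t)) \<cdot>
      ((k \<otimes> (swap (trg C e) (trg C x) (trg C t) f' \<cdot> (e \<otimes> (x \<otimes> t))))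
        \<cdot> assoc C (src C k) (src C e) (src C x \<odot> src C t))"
    using assms(1-10) assoc_nat[of k e "x \<otimes> t"] by (simp add: middle_def)
  also have "\<dots> = inv_arr C (assoc C (trg C k) (trg C x) (trg C e \<odot> trg C t)) \<cdot>
      ((k \<otimes> (x \<otimes> (e \<otimes> t))) \<cdot> ((ide C (src C k) \<otimes> swap (src C e) (src C x) (src C t) f)
        \<cdot> assoc C (src C k) (src C e) (src C x \<odot> src C t)))"
    unfolding s using assms(1-10) by simp
  also have "\<dots> = ((k \<otimes> x) \<otimes> (e \<otimes> t)) \<cdot> middle (src C k) (src C e) (src C x) (src C t) f"
    using assms(1-10) cmp_extend[OF inv_assoc_nat[of k x "e \<otimes> t"]]
    by (simp add: middle_def del: merge)
  finally show ?thesis .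
qed

lemma swap_inverse:
  assumes "E \<in> Obj C" "X \<in> Obj C" "T \<in> Obj C" "iso C f" "src C f = E \<odot> X" "trg C f = X \<odot> E"
  shows "swap X E T (inv_arr C f) \<cdot> swap E X T f = ide C (E \<odot> (X \<odot> T))"
  using assms by (simp add: swap_def del: merge)

text \<open>The source of the cancellations in \<open>pairing_braid\<close>, where interchanges
  along a braiding meet interchanges along its inverse.\<close>

lemma middle_inverse:
  assumes "D \<in> Obj C" "E \<in> Obj C" "X \<in> Obj C" "Y \<in> Obj C"
    and "iso C f" "src C f = E \<odot> X" "trg C f = X \<odot> E"
  shows "middle D X E Y (inv_arr C f) \<cdot> middle D E X Y f = ide C ((D \<odot> E) \<odot> (X \<odot> Y))"
proof -
  have "(ide C D \<otimes> swap X E Y (inv_arr C f)) \<cdot> ((ide C D \<otimes> swap E X Y f) \<cdot> k) = k"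
    if "k \<in> Arr C" "trg C k = D \<odot> (E \<odot> (X \<odot> Y))" for k
    using that assms by (simp add: swap_inverse)
  then show ?thesis
    using assms by (simp add: middle_def del: merge)
qed

end

section \<open>Braidings\<close>

context braided_monoidal_category
begin

lemma braid_simps [simp]:
  assumes "X \<in> Obj C" "Y \<in> Obj C"
  shows "iso C (braid C X Y)" "src C (braid C X Y) = X \<odot> Y" "trg C (braid C X Y) = Y \<odot> X"
  using braid_hom[OF assms] braid_iso[OF assms] by (simp_all add: in_hom_iff)

lemma braid_nat:
  assumes "f \<in> Arr C" "g \<in> Arr C"
  shows "braid C (trg C f) (trg C g) \<cdot> (f \<otimes> g) = (g \<otimes> f) \<cdot> braid C (src C f) (src C g)"
  using braid_natural[of f "src C f" "trg C f" g "src C g" "trg C g"] assms by (simp add: in_hom_iff)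

abbreviation sw :: "'o \<Rightarrow> 'o \<Rightarrow> 'o \<Rightarrow> 'm" where
  "sw E X T \<equiv> swap E X T (braid C E X)"

text \<open>The hexagon solved for the braiding past a product and put in terms of
  \<open>swap\<close>, so that it can serve as a rewrite rule.\<close>

lemma braid_tensor_right:
  assumes "X \<in> Obj C" "Y \<in> Obj C" "Z \<in> Obj C"
  shows "braid C X (Y \<odot> Z) = inv_arr C (assoc C Y Z X) \<cdot> ((ide C Y \<otimes> braid C X Z) \<cdot> sw X Y Z)"
proof -
  have "inv_arr C (assoc C Y Z X) \<cdot> ((ide C Y \<otimes> braid C X Z) \<cdot> sw X Y Z)
    = inv_arr C (assoc C Y Z X) \<cdot> (((ide C Y \<otimes> braid C X Z) \<cdot> assoc C Y X Z \<cdot> (braid C X Y \<otimes> ide C Z))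
        \<cdot> inv_arr C (assoc C X Y Z))"
    using assms by (simp add: swap_def del: merge)
  also have "\<dots> = braid C X (Y \<odot> Z)"
    unfolding hexagon1[OF assms, symmetric] using assms by (simp del: merge)
  finally show ?thesis ..
qed

lemma braid_tensor_left:
  assumes "X \<in> Obj C" "Y \<in> Obj C" "Z \<in> Obj C"
  shows "braid C (X \<odot> Y) Z = sw X Z Y \<cdot> ((ide C X \<otimes> braid C Y Z) \<cdot> assoc C X Y Z)"
proof -
  have "sw X Z Y \<cdot> ((ide C X \<otimes> braid C Y Z) \<cdot> assoc C X Y Z)
    = assoc C Z X Y \<cdot> (((braid C X Z \<otimes> ide C Y) \<cdot> inv_arr C (assoc C X Z Y) \<cdot> (ide C X \<otimes> braid C Y Z))
        \<cdot> assoc C X Y Z)"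
    using assms by (simp add: swap_def del: merge)
  also have "\<dots> = braid C (X \<odot> Y) Z"
    unfolding hexagon2[OF assms, symmetric] using assms by (simp del: merge)
  finally show ?thesis ..
qed

lemma sw_tensor_left:
  assumes "A \<in> Obj C" "B \<in> Obj C" "D \<in> Obj C" "T \<in> Obj C"
  shows "sw (A \<odot> B) D T = (ide C D \<otimes> inv_arr C (assoc C A B T)) \<cdot> (sw A D (B \<odot> T) \<cdot>
        ((ide C A \<otimes> sw B D T) \<cdot> assoc C A B (D \<odot> T)))"
  using swap_tensor_left[of A B D T "braid C A D" "braid C B D"] assms
  by (simp add: braid_tensor_left)

lemma sw_tensor_right:
  assumes "F \<in> Obj C" "X \<in> Obj C" "Y \<in> Obj C" "T \<in> Obj C"
  shows "sw F (X \<odot> Y) T = inv_arr C (assoc C X Y (F \<odot> T)) \<cdot> ((ide C X \<otimes> sw F Y T) \<cdot>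
        (sw F X (Y \<odot> T) \<cdot> (ide C F \<otimes> assoc C X Y T)))"
  using swap_tensor_right[of F X Y T "braid C F X" "braid C F Y"] assms
  by (simp add: braid_tensor_right)

text \<open>Two strands crossing two strands make four crossings: the inner pair \<open>B\<close>,
  \<open>D\<close> first, then \<open>A\<close> past \<open>D\<close> beside \<open>B\<close> past
  \<open>E\<close>, and finally \<open>A\<close> past \<open>E\<close>.\<close>

lemma braid_tensor_tensor:
  assumes "A \<in> Obj C" "B \<in> Obj C" "D \<in> Obj C" "E \<in> Obj C"
  shows "braid C (A \<odot> B) (D \<odot> E) = middle D A E B (braid C A E) \<cdot>
    ((braid C A D \<otimes> braid C B E) \<cdot> middle A B D E (braid C B D))"
proof -
  \<comment> \<open>The two parallel crossings are put in sequence, so that the one of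
    \<open>A\<close> past \<open>D\<close> becomes a \<open>sw\<close> and matches the hexagon
    expansion.\<close>
  have "assoc C D A (E \<odot> B) \<cdot> (braid C A D \<otimes> braid C B E)
      = assoc C D A (E \<odot> B) \<cdot> ((ide C (D \<odot> A) \<otimes> braid C B E) \<cdot> (braid C A D \<otimes> ide C (B \<odot> E)))"
    using assms by simp
  also have "\<dots> = (ide C D \<otimes> (ide C A \<otimes> braid C B E)) \<cdot> (sw A D (B \<odot> E) \<cdot> assoc C A D (B \<odot> E))"
    using assms by (simp add: swap_def cmp_extend[OF assoc_nat_outer] del: merge)
  finally have *: "assoc C D A (E \<odot> B) \<cdot> (braid C A D \<otimes> braid C B E)
      = (ide C D \<otimes> (ide C A \<otimes> braid C B E)) \<cdot> (sw A D (B \<odot> E) \<cdot> assoc C A D (B \<odot> E))" .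
  show ?thesis
    using assms by (simp add: middle_def cmp_extend[OF *] braid_tensor_right[of "A \<odot> B"]
      sw_tensor_left braid_tensor_left[of A B E] expand del: merge)
qed

text \<open>The hexagon at two unit objects contains the braiding past \<open>?I \<odot> ?I\<close>,
  which naturality reduces to \<open>?c\<close>. Unit coherence on both sides leaves the claim up to
  an invertible \<open>?c\<close> and an extra unit factor.\<close>

lemma braid_unit_right:
  assumes "X \<in> Obj C"
  shows "lunit C X \<cdot> braid C X (unit_obj C) = runit C X"
proof (rule tens_unit_right_inj)
  let ?I = "unit_obj C"
  let ?c = "braid C X ?I"
  have "?c \<cdot> ((lunit C X \<cdot> ?c) \<otimes> ide C ?I) = ?c \<cdot> (lunit C (X \<odot> ?I) \<cdot> (assoc C ?I X ?I \<cdot> (?c \<otimes> ide C ?I)))"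
    using assms by (simp add: expand cmp_extend[OF lunit_tensor] del: merge)
  also have "\<dots> = lunit C (?I \<odot> X) \<cdot> ((ide C ?I \<otimes> ?c) \<cdot> assoc C ?I X ?I \<cdot> (?c \<otimes> ide C ?I))"
    using assms cmp_extend[OF lunit_nat[of ?c], symmetric] by (simp del: merge)
  also have "\<dots> = (lunit C ?I \<otimes> ide C X) \<cdot> (braid C X (?I \<odot> ?I) \<cdot> assoc C X ?I ?I)"
    unfolding hexagon1[OF assms unit_Obj unit_Obj, symmetric]
    using assms by (simp add: cmp_extend[OF lunit_tensor] del: merge)
  also have "\<dots> = ?c \<cdot> ((ide C X \<otimes> lunit C ?I) \<cdot> assoc C X ?I ?I)"
    using assms cmp_extend[OF braid_nat[of "ide C X" "lunit C ?I"]] by (simp del: merge)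
  also have "\<dots> = ?c \<cdot> (runit C X \<otimes> ide C ?I)"
    using assms by (simp only: triangle_simp unit_Obj)
  finally have *: "?c \<cdot> ((lunit C X \<cdot> ?c) \<otimes> ide C ?I) = ?c \<cdot> (runit C X \<otimes> ide C ?I)" .
  show "(lunit C X \<cdot> ?c) \<otimes> ide C ?I = runit C X \<otimes> ide C ?I"
    by (rule iso_monic[OF _ *]) (use assms in simp_all)
qed (use assms in simp_all)

lemma braid_unit_unit: "braid C (unit_obj C) (unit_obj C) = ide C (unit_obj C \<odot> unit_obj C)"
  by (rule iso_monic[of "lunit C (unit_obj C)"])
    (use braid_unit_right[of "unit_obj C"] in \<open>simp_all add: lunit_unit_obj\<close>)

end

section \<open>The reversed braiding\<close>

definition rev_braided :: "('o, 'm, 'x) braided_data_scheme \<Rightarrow> ('o, 'm, 'x) braided_data_scheme" where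
  "rev_braided C = C\<lparr>braid := \<lambda>X Y. inv_arr C (braid C Y X)\<rparr>"

lemma rev_braided_simps [simp]:
  "Obj (rev_braided C) = Obj C" "Arr (rev_braided C) = Arr C"
  "src (rev_braided C) = src C" "trg (rev_braided C) = trg C"
  "ide (rev_braided C) = ide C" "cmp (rev_braided C) = cmp C"
  "tens_obj (rev_braided C) = tens_obj C" "tens (rev_braided C) = tens C"
  "unit_obj (rev_braided C) = unit_obj C" "assoc (rev_braided C) = assoc C"
  "lunit (rev_braided C) = lunit C" "runit (rev_braided C) = runit C"
  "braid (rev_braided C) = (\<lambda>X Y. inv_arr C (braid C Y X))"
  by (simp_all add: rev_braided_def)

lemma rev_braided_derived_simps [simp]:
  "hom (rev_braided C) = hom C" "iso (rev_braided C) = iso C" "inv_arr (rev_braided C) = inv_arr C"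
  by (simp_all add: fun_eq_iff hom_def iso_def inv_arr_def inverse_arrows_def)

text \<open>Inverting either hexagon gives the other one for the inverse braiding. Every result
  proved for an arbitrary braiding thereby comes in a second version.\<close>

lemma (in braided_monoidal_category) rev_braided_monoidal_category:
  "braided_monoidal_category (rev_braided C)"
proof -
  have "monoidal_category (rev_braided C)"
    using monoidal_category_axioms
    by (simp add: monoidal_category_def monoidal_category_axioms_def category_def)
  moreover have "braided_monoidal_category_axioms (rev_braided C)"
  proof (unfold_locales, unfold rev_braided_simps rev_braided_derived_simps, goal_cases)
    case (1 X Y)
    then show ?case by (simp add: in_hom_iff)
  next
    case (2 X Y)
    then show ?case by simp
  next
    case (3 f X X' g Y Y')
    then have [simp]: "f \<in> Arr C" "g \<in> Arr C" "src C f = X" "trg C f = X'" "src C g = Y" "trg C g = Y'"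
      by (auto simp: in_hom_iff)
    have [simp]: "X \<in> Obj C" "X' \<in> Obj C" "Y \<in> Obj C" "Y' \<in> Obj C"
      using src_mem[of f] trg_mem[of f] src_mem[of g] trg_mem[of g] by auto
    show ?case
      using inv_square[OF _ _ braid_nat[of g f]] by simp
  next
    case (4 X Y Z)
    then show ?case
      using arg_cong[OF hexagon2[of Y Z X], of "inv_arr C"] by (simp del: merge)
  next
    case (5 X Y Z)
    then show ?case
      using arg_cong[OF hexagon1[of Z X Y], of "inv_arr C"] by (simp del: merge)
  qed
  ultimately show ?thesis
    by (simp add: braided_monoidal_category_def)
qed

lemma (in braided_monoidal_category) braid_unit_left:
  assumes "X \<in> Obj C"
  shows "runit C X \<cdot> braid C (unit_obj C) X = lunit C X"
proof -
  interpret rev: braided_monoidal_category "rev_braided C"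
    by (rule rev_braided_monoidal_category)
  have "lunit C X \<cdot> inv_arr C (braid C (unit_obj C) X) = runit C X"
    using rev.braid_unit_right[of X] assms by simp
  then show ?thesis
    using assms by (simp add: flip: \<open>lunit C X \<cdot> inv_arr C (braid C (unit_obj C) X) = runit C X\<close>)
qed

section \<open>Products of pairings\<close>

context braided_monoidal_category
begin

definition slide :: "'o \<Rightarrow> 'o \<Rightarrow> 'o \<Rightarrow> 'm \<Rightarrow> 'm" where
  "slide E X Y q = runit C X \<cdot> ((ide C X \<otimes> q) \<cdot> sw E X Y)"

text \<open>The factors \<open>p\<close> and \<open>q\<close> are not tied to \<open>ev\<close>:
  associativity of \<open>\<phi>2\<close> pairs a product of evaluations once more, and its mate
  pairs evaluations composed with a braiding.\<close>

definition pairing :: "'o \<Rightarrow> 'o \<Rightarrow> 'o \<Rightarrow> 'o \<Rightarrow> 'm \<Rightarrow> 'm \<Rightarrow> 'm" where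
  "pairing D E X Y p q = unit_mult C \<cdot> ((p \<otimes> q) \<cdot> middle D E X Y (braid C E X))"

lemma unit_mult_simps [simp]:
  "unit_mult C \<in> Arr C" "src C (unit_mult C) = unit_obj C \<odot> unit_obj C" "trg C (unit_mult C) = unit_obj C"
  by (simp_all add: unit_mult_def)

lemma slide_simps [simp]:
  assumes "E \<in> Obj C" "X \<in> Obj C" "Y \<in> Obj C"
    "q \<in> Arr C" "src C q = E \<odot> Y" "trg C q = unit_obj C"
  shows "slide E X Y q \<in> Arr C" "src C (slide E X Y q) = E \<odot> (X \<odot> Y)" "trg C (slide E X Y q) = X"
  using assms by (simp_all add: slide_def)

lemma pairing_simps [simp]:
  assumes "D \<in> Obj C" "E \<in> Obj C" "X \<in> Obj C" "Y \<in> Obj C"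
    "p \<in> Arr C" "src C p = D \<odot> X" "trg C p = unit_obj C"
    "q \<in> Arr C" "src C q = E \<odot> Y" "trg C q = unit_obj C"
  shows "pairing D E X Y p q \<in> Arr C" "src C (pairing D E X Y p q) = (D \<odot> E) \<odot> (X \<odot> Y)"
    "trg C (pairing D E X Y p q) = unit_obj C"
  using assms by (simp_all add: pairing_def)

text \<open>Of the two parallel pairings, \<open>q\<close> can be evaluated first; naturality of
  \<open>runit\<close> then moves \<open>p\<close> to the outside. In this form iterated products
  become nests without parallel factors.\<close>

lemma pairing_eq_slide:
  assumes "D \<in> Obj C" "E \<in> Obj C" "X \<in> Obj C" "Y \<in> Obj C"
    "p \<in> Arr C" "src C p = D \<odot> X" "trg C p = unit_obj C"
    "q \<in> Arr C" "src C q = E \<odot> Y" "trg C q = unit_obj C"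
  shows "pairing D E X Y p q = p \<cdot> ((ide C D \<otimes> slide E X Y q) \<cdot> assoc C D E (X \<odot> Y))"
proof -
  have "unit_mult C \<cdot> (p \<otimes> q) = runit C (unit_obj C) \<cdot> ((p \<otimes> ide C (unit_obj C)) \<cdot> (ide C (D \<odot> X) \<otimes> q))"
    using assms by (simp add: unit_mult_def lunit_unit_obj)
  also have "\<dots> = p \<cdot> (runit C (D \<odot> X) \<cdot> (ide C (D \<odot> X) \<otimes> q))"
    using assms cmp_extend[OF runit_nat[of p], of "ide C (D \<odot> X) \<otimes> q"] by (simp del: merge)
  also have "\<dots> = p \<cdot> ((ide C D \<otimes> runit C X) \<cdot> ((ide C D \<otimes> (ide C X \<otimes> q)) \<cdot> assoc C D X (E \<odot> Y)))"
    using assms by (simp add: runit_tensor[symmetric] assoc_nat_outer del: merge)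
  finally have *: "unit_mult C \<cdot> (p \<otimes> q) = \<dots>" .
  show ?thesis
    using assms cmp_extend[OF *, of "middle D E X Y (braid C E X)"]
    by (simp add: pairing_def slide_def middle_def expand del: merge)
qed

text \<open>By the hexagon, \<open>F\<close> passes \<open>X\<close> and then \<open>Y\<close>; the
  cap \<open>r\<close> acts only in the second passage.\<close>

lemma slide_tensor:
  assumes "F \<in> Obj C" "X \<in> Obj C" "Y \<in> Obj C" "Z \<in> Obj C"
    "r \<in> Arr C" "src C r = F \<odot> Z" "trg C r = unit_obj C"
  shows "slide F (X \<odot> Y) Z r
    = (ide C X \<otimes> slide F Y Z r) \<cdot> (sw F X (Y \<odot> Z) \<cdot> (ide C F \<otimes> assoc C X Y Z))"
  using assms
  by (simp add: slide_def sw_tensor_right runit_tensor[symmetric] cmp_extend[OF assoc_nat_outer]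
      expand del: merge)

lemma slide_pairing:
  assumes "E \<in> Obj C" "F \<in> Obj C" "X \<in> Obj C" "Y \<in> Obj C" "Z \<in> Obj C"
    "q \<in> Arr C" "src C q = E \<odot> Y" "trg C q = unit_obj C"
    "r \<in> Arr C" "src C r = F \<odot> Z" "trg C r = unit_obj C"
  shows "slide (E \<odot> F) X (Y \<odot> Z) (pairing E F Y Z q r)
    = slide E X Y q \<cdot> ((ide C E \<otimes> slide F (X \<odot> Y) Z r) \<cdot>
        ((ide C E \<otimes> (ide C F \<otimes> inv_arr C (assoc C X Y Z))) \<cdot> assoc C E F (X \<odot> (Y \<odot> Z))))"
proof -
  let ?r = "slide F Y Z r"
  \<comment> \<open>Naturality of the braiding: the cap \<open>?r\<close> may be applied before or
    after \<open>E\<close> passes \<open>X\<close>.\<close>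
  have *: "(ide C X \<otimes> (ide C E \<otimes> ?r)) \<cdot> sw E X (F \<odot> (Y \<odot> Z)) = sw E X Y \<cdot> (ide C E \<otimes> (ide C X \<otimes> ?r))"
    using assms swap_nat[of "ide C E" "ide C X" ?r "braid C E X" "braid C E X"] by simp
  have "slide (E \<odot> F) X (Y \<odot> Z) (pairing E F Y Z q r)
    = runit C X \<cdot> ((ide C X \<otimes> q) \<cdot> ((ide C X \<otimes> (ide C E \<otimes> ?r)) \<cdot>
       (sw E X (F \<odot> (Y \<odot> Z)) \<cdot> ((ide C E \<otimes> sw F X (Y \<odot> Z)) \<cdot> assoc C E F (X \<odot> (Y \<odot> Z))))))"
    using assms by (simp add: slide_def[of "E \<odot> F"] pairing_eq_slide sw_tensor_left expand del: merge)
  also have "\<dots> = slide E X Y q \<cdot> ((ide C E \<otimes> (ide C X \<otimes> ?r)) \<cdot>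
       ((ide C E \<otimes> sw F X (Y \<odot> Z)) \<cdot> assoc C E F (X \<odot> (Y \<odot> Z))))"
    using assms by (simp add: cmp_extend[OF *] slide_def[of E] del: merge)
  also have "\<dots> = slide E X Y q \<cdot> ((ide C E \<otimes> slide F (X \<odot> Y) Z r) \<cdot>
        ((ide C E \<otimes> (ide C F \<otimes> inv_arr C (assoc C X Y Z))) \<cdot> assoc C E F (X \<odot> (Y \<odot> Z))))"
    using assms by (simp add: slide_tensor)
  finally show ?thesis .
qed

text \<open>Both bracketings unfold to one nest: \<open>r\<close> slides past
  \<open>X \<odot> Y\<close>, then \<open>q\<close> past \<open>X\<close>, then \<open>p\<close> is
  applied. Only associators remain to be compared, which is the pentagon.\<close>

lemma pairing_assoc:
  assumes "D \<in> Obj C" "E \<in> Obj C" "F \<in> Obj C" "X \<in> Obj C" "Y \<in> Obj C" "Z \<in> Obj C"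
    "p \<in> Arr C" "src C p = D \<odot> X" "trg C p = unit_obj C"
    "q \<in> Arr C" "src C q = E \<odot> Y" "trg C q = unit_obj C"
    "r \<in> Arr C" "src C r = F \<odot> Z" "trg C r = unit_obj C"
  shows "pairing D (E \<odot> F) X (Y \<odot> Z) p (pairing E F Y Z q r) \<cdot> (assoc C D E F \<otimes> assoc C X Y Z)
    = pairing (D \<odot> E) F (X \<odot> Y) Z (pairing D E X Y p q) r"
proof -
  have "assoc C D (E \<odot> F) (X \<odot> (Y \<odot> Z)) \<cdot> (assoc C D E F \<otimes> assoc C X Y Z)
    = assoc C D (E \<odot> F) (X \<odot> (Y \<odot> Z)) \<cdot> ((assoc C D E F \<otimes> ide C (X \<odot> (Y \<odot> Z))) \<cdot>
        (ide C ((D \<odot> E) \<odot> F) \<otimes> assoc C X Y Z))"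
    using assms by simp
  also have "\<dots> = (ide C D \<otimes> inv_arr C (assoc C E F (X \<odot> (Y \<odot> Z)))) \<cdot>
      ((ide C D \<otimes> (ide C E \<otimes> (ide C F \<otimes> assoc C X Y Z))) \<cdot>
        (assoc C D E (F \<odot> ((X \<odot> Y) \<odot> Z)) \<cdot> assoc C (D \<odot> E) F ((X \<odot> Y) \<odot> Z)))"
    using assms by (simp add: cmp_extend[OF pentagon_left] assoc_nat_outer cmp_extend[OF assoc_nat_outer]
      del: merge)
  finally have *: "assoc C D (E \<odot> F) (X \<odot> (Y \<odot> Z)) \<cdot> (assoc C D E F \<otimes> assoc C X Y Z) = \<dots>" .
  \<comment> \<open>The inverse associator produced by \<open>slide_pairing\<close> meets the
    associator on the second factor in the claim.\<close>
  have **: "(ide C D \<otimes> (ide C E \<otimes> (ide C F \<otimes> inv_arr C (assoc C X Y Z)))) \<cdot>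
      ((ide C D \<otimes> (ide C E \<otimes> (ide C F \<otimes> assoc C X Y Z))) \<cdot> k) = k"
    if "k \<in> Arr C" "trg C k = D \<odot> (E \<odot> (F \<odot> ((X \<odot> Y) \<odot> Z)))" for k
    using that assms by simp
  show ?thesis
    using assms by (simp add: pairing_eq_slide[of D] pairing_eq_slide[of "D \<odot> E"] slide_pairing * **
      cmp_extend[OF assoc_nat_outer] expand del: merge)
qed

text \<open>Passing the unit object costs only unit constraints, so sliding \<open>q\<close> past it
  is \<open>q\<close> after removal of the unit. Naturality and coherence of \<open>lunit\<close> do
  the rest.\<close>

lemma pairing_unit_left:
  assumes "E \<in> Obj C" "Y \<in> Obj C" "q \<in> Arr C" "src C q = E \<odot> Y" "trg C q = unit_obj C"
  shows "pairing (unit_obj C) E (unit_obj C) Y (unit_mult C) q \<cdot>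
      (ide C (unit_obj C \<odot> E) \<otimes> inv_arr C (lunit C Y)) = q \<cdot> (lunit C E \<otimes> ide C Y)"
proof -
  let ?I = "unit_obj C"
  have n: "runit C ?I \<cdot> (ide C ?I \<otimes> q) = q \<cdot> lunit C (E \<odot> Y)"
    using lunit_nat[of q] assms by (simp add: lunit_unit_obj)
  have "slide E ?I Y q = q \<cdot> (lunit C (E \<odot> Y) \<cdot> sw E ?I Y)"
    using assms by (simp add: slide_def cmp_extend[OF n])
  also have "\<dots> = q \<cdot> (((lunit C E \<cdot> braid C E ?I) \<otimes> ide C Y) \<cdot> inv_arr C (assoc C E ?I Y))"
    using assms by (simp add: swap_def cmp_extend[OF lunit_tensor])
  also have "\<dots> = q \<cdot> (ide C E \<otimes> lunit C Y)"
    using assms by (simp add: braid_unit_right triangle_simp[symmetric])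
  finally have s: "slide E ?I Y q = q \<cdot> (ide C E \<otimes> lunit C Y)" .
  have "pairing ?I E ?I Y (unit_mult C) q \<cdot> (ide C (?I \<odot> E) \<otimes> inv_arr C (lunit C Y))
    = lunit C ?I \<cdot> ((ide C ?I \<otimes> q) \<cdot> assoc C ?I E Y)"
    using assms by (simp add: pairing_eq_slide s assoc_nat_outer unit_mult_def)
  also have "\<dots> = q \<cdot> (lunit C (E \<odot> Y) \<cdot> assoc C ?I E Y)"
    using assms cmp_extend[OF lunit_nat[of q]] by simp
  also have "\<dots> = q \<cdot> (lunit C E \<otimes> ide C Y)"
    using assms by (simp add: lunit_tensor)
  finally show ?thesis .
qed

lemma pairing_unit_right:
  assumes "D \<in> Obj C" "X \<in> Obj C" "p \<in> Arr C" "src C p = D \<odot> X" "trg C p = unit_obj C"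
  shows "pairing D (unit_obj C) X (unit_obj C) p (unit_mult C) \<cdot>
      (ide C (D \<odot> unit_obj C) \<otimes> inv_arr C (runit C X)) = p \<cdot> (runit C D \<otimes> ide C X)"
proof -
  let ?I = "unit_obj C"
  have "slide ?I X ?I (unit_mult C) = runit C X \<cdot> (((ide C X \<otimes> lunit C ?I) \<cdot> assoc C X ?I ?I) \<cdot>
      ((braid C ?I X \<otimes> ide C ?I) \<cdot> inv_arr C (assoc C ?I X ?I)))"
    using assms by (simp add: slide_def swap_def unit_mult_def del: merge)
  also have "\<dots> = runit C X \<cdot> (((runit C X \<cdot> braid C ?I X) \<otimes> ide C ?I) \<cdot> inv_arr C (assoc C ?I X ?I))"
    unfolding triangle_simp[OF assms(2) unit_Obj] using assms by simp
  also have "\<dots> = runit C X \<cdot> lunit C (X \<odot> ?I)"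
    using assms by (simp add: braid_unit_left lunit_tensor[symmetric])
  also have "\<dots> = lunit C X \<cdot> (ide C ?I \<otimes> runit C X)"
    using assms lunit_nat[of "runit C X"] by simp
  \<comment> \<open>The slide of the trivial pairing just forgets both units; then the triangle
    gives the claim.\<close>
  finally have s: "slide ?I X ?I (unit_mult C) = lunit C X \<cdot> (ide C ?I \<otimes> runit C X)" .
  show ?thesis
    using assms by (simp add: pairing_eq_slide s assoc_nat_outer triangle_simp[symmetric])
qed

lemma pairing_nat:
  assumes "D \<in> Obj C" "E \<in> Obj C" "X \<in> Obj C" "Y \<in> Obj C"
    "p \<in> Arr C" "src C p = D \<odot> X" "trg C p = unit_obj C"
    "q \<in> Arr C" "src C q = E \<odot> Y" "trg C q = unit_obj C"
    "k \<in> Arr C" "trg C k = D" "e \<in> Arr C" "trg C e = E"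
    "x \<in> Arr C" "trg C x = X" "y \<in> Arr C" "trg C y = Y"
  shows "pairing D E X Y p q \<cdot> ((k \<otimes> e) \<otimes> (x \<otimes> y))
    = pairing (src C k) (src C e) (src C x) (src C y) (p \<cdot> (k \<otimes> x)) (q \<cdot> (e \<otimes> y))"
proof -
  have "middle D E X Y (braid C E X) \<cdot> ((k \<otimes> e) \<otimes> (x \<otimes> y)) = ((k \<otimes> x) \<otimes> (e \<otimes> y)) \<cdot>
      middle (src C k) (src C e) (src C x) (src C y) (braid C (src C e) (src C x))"
    using middle_nat[of k e x y "braid C (src C e) (src C x)" "braid C E X"] braid_nat[of e x] assms by simp
  then show ?thesis
    using assms by (simp add: pairing_def)
qed

end

text \<open>
  The two sides nest their caps in opposite orders; moving one cap across the other costs nothing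
  because the braiding at \<open>I \<otimes> I\<close> is trivial, and both sides then expand by
  \<open>braid_tensor_tensor\<close>. The cancellations need the pairings to be built with the reversed braiding.
\<close>

lemma (in braided_monoidal_category) pairing_braid:
  assumes "D \<in> Obj C" "E \<in> Obj C" "X \<in> Obj C" "Y \<in> Obj C"
    "p \<in> Arr C" "src C p = D \<odot> X" "trg C p = unit_obj C"
    "q \<in> Arr C" "src C q = E \<odot> Y" "trg C q = unit_obj C"
  shows "braided_monoidal_category.pairing (rev_braided C) X Y D E
      (p \<cdot> braid C X D) (q \<cdot> braid C Y E)
    = braided_monoidal_category.pairing (rev_braided C) E D Y X q p \<cdot>
      ((braid C D E \<otimes> braid C X Y) \<cdot> braid C (X \<odot> Y) (D \<odot> E))"
proof -
  interpret rev: braided_monoidal_category "rev_braided C"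
    by (rule rev_braided_monoidal_category)
  have rev_middle: "rev.middle = middle"
    by (simp add: fun_eq_iff rev.middle_def middle_def rev.swap_def swap_def)
  have rev_pairing: "rev.pairing D' E' X' Y' p' q'
      = unit_mult C \<cdot> ((p' \<otimes> q') \<cdot> middle D' E' X' Y' (inv_arr C (braid C X' E')))" for D' E' X' Y' p' q'
    by (simp add: rev.pairing_def rev_middle unit_mult_def)
  \<comment> \<open>Both sides reduce to the braidings of \<open>Y\<close> with \<open>E\<close> and
    of \<open>X\<close> with \<open>D\<close> after \<open>?M\<close>, once the crossing of
    \<open>D\<close> with \<open>Y\<close>, respectively \<open>Y\<close> with \<open>D\<close>, has
    cancelled.\<close>
  let ?M = "middle Y X E D (braid C X E) \<cdot> (braid C X Y \<otimes> braid C D E)"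
  have "unit_mult C \<cdot> (p \<otimes> q) = unit_mult C \<cdot> (braid C (unit_obj C) (unit_obj C) \<cdot> (p \<otimes> q))"
    using assms by (simp add: braid_unit_unit)
  also have "\<dots> = unit_mult C \<cdot> ((q \<otimes> p) \<cdot> braid C (D \<odot> X) (E \<odot> Y))"
    using braid_nat[of p q] assms by simp
  finally have pq: "unit_mult C \<cdot> (p \<otimes> q) = unit_mult C \<cdot> ((q \<otimes> p) \<cdot> braid C (D \<odot> X) (E \<odot> Y))" .
  have 1: "braid C (D \<odot> X) (E \<odot> Y) \<cdot> (braid C X D \<otimes> braid C Y E)
      = (braid C Y E \<otimes> braid C X D) \<cdot> braid C (X \<odot> D) (Y \<odot> E)"
    using braid_nat[of "braid C X D" "braid C Y E"] assms by simp
  have 2: "braid C (X \<odot> D) (Y \<odot> E) \<cdot> middle X Y D E (inv_arr C (braid C D Y)) = ?M"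
    using assms middle_inverse[of X Y D E "inv_arr C (braid C D Y)"]
    by (simp add: braid_tensor_tensor del: merge)
  have 3: "(braid C D E \<otimes> braid C X Y) \<cdot> braid C (X \<odot> Y) (D \<odot> E)
      = braid C (Y \<odot> X) (E \<odot> D) \<cdot> (braid C X Y \<otimes> braid C D E)"
    using braid_nat[of "braid C X Y" "braid C D E"] assms by simp
  have 4: "middle E D Y X (inv_arr C (braid C Y D)) \<cdot> (middle E Y D X (braid C Y D) \<cdot> k) = k"
    if "k \<in> Arr C" "trg C k = (E \<odot> Y) \<odot> (D \<odot> X)" for k
    using that assms cmp_extend[OF middle_inverse[of E Y D X "braid C Y D"], of k] by simp
  have "rev.pairing X Y D E (p \<cdot> braid C X D) (q \<cdot> braid C Y E)
      = (unit_mult C \<cdot> (p \<otimes> q)) \<cdot> ((braid C X D \<otimes> braid C Y E) \<cdot> middle X Y D E (inv_arr C (braid C D Y)))"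
    unfolding rev_pairing using assms by simp
  also have "\<dots> = unit_mult C \<cdot> ((q \<otimes> p) \<cdot> ((braid C Y E \<otimes> braid C X D) \<cdot> ?M))"
    unfolding pq using assms by (simp add: cmp_extend[OF 1] 2 del: merge)
  also have "\<dots> = rev.pairing E D Y X q p \<cdot> (braid C (Y \<odot> X) (E \<odot> D) \<cdot> (braid C X Y \<otimes> braid C D E))"
    unfolding rev_pairing using assms by (simp add: braid_tensor_tensor 4 del: merge)
  finally show ?thesis
    unfolding 3 .
qed

section \<open>Opposite categories and opposite algebras\<close>

lemma op_mon_simps [simp]:
  "Obj (op_mon C) = Obj C" "Arr (op_mon C) = Arr C" "src (op_mon C) = trg C" "trg (op_mon C) = src C"
  "ide (op_mon C) = ide C" "cmp (op_mon C) = (\<lambda>g f. f \<cdot>\<^bsub>C\<^esub> g)"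
  "tens_obj (op_mon C) = tens_obj C" "tens (op_mon C) = tens C" "unit_obj (op_mon C) = unit_obj C"
  "assoc (op_mon C) = (\<lambda>X Y Z. inv_arr C (assoc C X Y Z))"
  "lunit (op_mon C) = (\<lambda>X. inv_arr C (lunit C X))"
  "runit (op_mon C) = (\<lambda>X. inv_arr C (runit C X))"
  by (simp_all add: op_mon_def)

lemma op_mon_derived_simps [simp]:
  "hom (op_mon C) X Y = hom C Y X" "iso (op_mon C) = iso C" "inv_arr (op_mon C) = inv_arr C"
  by (auto simp: fun_eq_iff hom_def iso_def inv_arr_def inverse_arrows_def
      intro!: arg_cong[where f = The] arg_cong[where f = Ex])

lemma (in monoidal_category) op_monoidal_category: "monoidal_category (op_mon C)"
proof (unfold_locales, unfold op_mon_simps op_mon_derived_simps, goal_cases)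
  case (6 f X Y)
  then show ?case by (auto simp: in_hom_iff)
next
  case (7 f W X g Y h Z)
  then show ?case by (auto simp: in_hom_iff)
next
  case (15 f X X' g Y Y' h Z Z')
  then show ?case
    using inv_assoc_nat[of f g h] by (simp add: in_hom_iff)
next
  case (18 f X Y)
  then show ?case
    using inv_square[OF _ _ lunit_nat[of f]] by (auto simp: in_hom_iff)
next
  case (21 f X Y)
  then show ?case
    using inv_square[OF _ _ runit_nat[of f]] by (auto simp: in_hom_iff)
next
  case (22 W X Y Z)
  then show ?case
    using arg_cong[OF pentagon[of W X Y Z], of "inv_arr C"] by (simp del: merge)
next
  case (23 X Y)
  then show ?case
    using arg_cong[OF triangle[of X Y], of "inv_arr C"] by simp
qed (auto simp: in_hom_iff)

text \<open>The arguments of \<open>braid\<close> are exchanged because arrows are reversed. With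
  this choice, rather than its inverse, the opposite of an algebra of the opposite category has the
  comultiplication \<open>\<Delta>\<close> followed by c. A full record is needed since
  \<open>op_mon\<close> drops the braiding.\<close>

definition op_braided :: "('o, 'm, 'x) braided_data_scheme \<Rightarrow> ('o, 'm) braided_data" where
  "op_braided C =
    \<lparr> Obj = Obj C, Arr = Arr C, src = trg C, trg = src C, ide = ide C,
      cmp = (\<lambda>g f. f \<cdot>\<^bsub>C\<^esub> g),
      tens_obj = tens_obj C, tens = tens C, unit_obj = unit_obj C,
      assoc = (\<lambda>X Y Z. inv_arr C (assoc C X Y Z)),
      lunit = (\<lambda>X. inv_arr C (lunit C X)),
      runit = (\<lambda>X. inv_arr C (runit C X)),
      braid = (\<lambda>X Y. braid C Y X) \<rparr>"

lemma op_braided_simps [simp]: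
  "Obj (op_braided C) = Obj (op_mon C)" "Arr (op_braided C) = Arr (op_mon C)"
  "src (op_braided C) = src (op_mon C)" "trg (op_braided C) = trg (op_mon C)"
  "ide (op_braided C) = ide (op_mon C)" "cmp (op_braided C) = cmp (op_mon C)"
  "tens_obj (op_braided C) = tens_obj (op_mon C)" "tens (op_braided C) = tens (op_mon C)"
  "unit_obj (op_braided C) = unit_obj (op_mon C)" "assoc (op_braided C) = assoc (op_mon C)"
  "lunit (op_braided C) = lunit (op_mon C)" "runit (op_braided C) = runit (op_mon C)"
  "braid (op_braided C) = (\<lambda>X Y. braid C Y X)"
  by (simp_all add: op_braided_def)

lemma op_braided_derived_simps [simp]:
  "hom (op_braided C) = hom (op_mon C)" "iso (op_braided C) = iso (op_mon C)"
  "inv_arr (op_braided C) = inv_arr (op_mon C)"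
proof -
  show hom: "hom (op_braided C) = hom (op_mon C)"
    by (simp add: fun_eq_iff hom_def)
  have "inverse_arrows (op_braided C) = inverse_arrows (op_mon C)"
    by (simp add: fun_eq_iff inverse_arrows_def hom)
  then show "iso (op_braided C) = iso (op_mon C)" "inv_arr (op_braided C) = inv_arr (op_mon C)"
    by (simp_all add: fun_eq_iff iso_def inv_arr_def del: op_mon_derived_simps)
qed

lemma (in braided_monoidal_category) op_braided_monoidal_category:
  "braided_monoidal_category (op_braided C)"
proof -
  have "monoidal_category (op_braided C)"
    using op_monoidal_category
    by (simp add: monoidal_category_def monoidal_category_axioms_def category_def)
  moreover have "braided_monoidal_category_axioms (op_braided C)"
  proof (unfold_locales, unfold op_braided_simps op_braided_derived_simps op_mon_simps op_mon_derived_simps, goal_cases)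
    case (3 f X X' g Y Y')
    then show ?case using braid_nat[of g f] by (auto simp: in_hom_iff)
  next
    case (4 X Y Z)
    then show ?case using hexagon2[of Y Z X] by (simp del: merge)
  next
    case (5 X Y Z)
    then show ?case using hexagon1[of Z X Y] by (simp del: merge)
  qed (simp_all add: in_hom_iff)
  ultimately show ?thesis
    by (simp add: braided_monoidal_category_def)
qed

section \<open>Opposite algebras\<close>

definition opposite ::
  "('o, 'm, 'x) braided_data_scheme \<Rightarrow> ('o, 'm) structured \<Rightarrow> ('o, 'm) structured" where
  "opposite C = (\<lambda>(A, m, u). (A, m \<cdot>\<^bsub>C\<^esub> braid C A A, u))"

lemma is_algebraD:
  assumes "is_algebra C (A, m, u)"
  shows "A \<in> Obj C" "m \<in> Arr C" "src C m = A \<odot>\<^bsub>C\<^esub> A" "trg C m = A"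
    "u \<in> Arr C" "src C u = unit_obj C" "trg C u = A"
    "m \<cdot>\<^bsub>C\<^esub> (m \<otimes>\<^bsub>C\<^esub> ide C A) = m \<cdot>\<^bsub>C\<^esub> (ide C A \<otimes>\<^bsub>C\<^esub> m) \<cdot>\<^bsub>C\<^esub> assoc C A A A"
    "m \<cdot>\<^bsub>C\<^esub> (u \<otimes>\<^bsub>C\<^esub> ide C A) = lunit C A" "m \<cdot>\<^bsub>C\<^esub> (ide C A \<otimes>\<^bsub>C\<^esub> u) = runit C A"
  using assms by (auto simp: is_algebra_def in_hom_iff)

context braided_monoidal_category
begin

text \<open>Naturality of the braiding with respect to itself, expanded by a hexagon. The bracketing
  is the one met in the associativity law of an opposite algebra.\<close>

lemma yang_baxter:
  assumes "A \<in> Obj C"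
  shows "(ide C A \<otimes> braid C A A) \<cdot> braid C (A \<odot> A) A
    = assoc C A A A \<cdot> ((braid C A A \<otimes> ide C A) \<cdot> (braid C A (A \<odot> A) \<cdot> assoc C A A A))"
proof -
  have "(braid C A A \<otimes> ide C A) \<cdot> braid C A (A \<odot> A) = braid C A (A \<odot> A) \<cdot> (ide C A \<otimes> braid C A A)"
    using braid_nat[of "ide C A" "braid C A A"] assms by simp
  from cmp_extend[OF this, of "assoc C A A A"] show ?thesis
    using assms by (simp add: braid_tensor_right braid_tensor_left[of A A A] del: merge)
qed

text \<open>Pulling the multiplications through the braidings leaves associativity of
  \<open>m\<close> and two ways of reversing three factors, which \<open>yang_baxter\<close>
  equates. The unit laws change sides because braiding with the unit object exchanges
  \<open>lunit\<close> and \<open>runit\<close>.\<close>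

lemma is_algebra_opposite:
  assumes "is_algebra C S"
  shows "is_algebra C (opposite C S)"
proof -
  obtain A m u where S: "S = (A, m, u)" by (cases S)
  note alg [simp] = is_algebraD(1-7)[OF assms[unfolded S]]
  note laws = is_algebraD(8-)[OF assms[unfolded S]]
  let ?c = "braid C A A"
  have m_assoc: "m \<cdot> (m \<otimes> ide C A) = m \<cdot> ((ide C A \<otimes> m) \<cdot> assoc C A A A)"
    using laws(1) by simp
  have 1: "?c \<cdot> ((m \<cdot> ?c) \<otimes> ide C A) = (ide C A \<otimes> (m \<cdot> ?c)) \<cdot> braid C (A \<odot> A) A"
    using braid_nat[of "m \<cdot> ?c" "ide C A"] by simp
  have 2: "?c \<cdot> (ide C A \<otimes> (m \<cdot> ?c)) = ((m \<cdot> ?c) \<otimes> ide C A) \<cdot> braid C A (A \<odot> A)"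
    using braid_nat[of "ide C A" "m \<cdot> ?c"] by simp
  have "(m \<cdot> ?c) \<cdot> ((m \<cdot> ?c) \<otimes> ide C A)
      = m \<cdot> ((ide C A \<otimes> m) \<cdot> ((ide C A \<otimes> ?c) \<cdot> braid C (A \<odot> A) A))"
    using 1 by (simp add: expand del: merge)
  also have "\<dots> = (m \<cdot> (m \<otimes> ide C A)) \<cdot> ((?c \<otimes> ide C A) \<cdot> (braid C A (A \<odot> A) \<cdot> assoc C A A A))"
    unfolding yang_baxter[OF alg(1)] m_assoc by (simp del: merge)
  also have "\<dots> = m \<cdot> ((((m \<cdot> ?c) \<otimes> ide C A) \<cdot> braid C A (A \<odot> A)) \<cdot> assoc C A A A)"
    by (simp add: expand del: merge)
  also have "\<dots> = (m \<cdot> ?c) \<cdot> (ide C A \<otimes> (m \<cdot> ?c)) \<cdot> assoc C A A A"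
    unfolding 2[symmetric] by (simp del: merge)
  finally have assoc: "(m \<cdot> ?c) \<cdot> ((m \<cdot> ?c) \<otimes> ide C A) = (m \<cdot> ?c) \<cdot> (ide C A \<otimes> (m \<cdot> ?c)) \<cdot> assoc C A A A" .
  have "(m \<cdot> ?c) \<cdot> (u \<otimes> ide C A) = (m \<cdot> (ide C A \<otimes> u)) \<cdot> braid C (unit_obj C) A"
    using braid_nat[of u "ide C A"] by simp
  then have lunit: "(m \<cdot> ?c) \<cdot> (u \<otimes> ide C A) = lunit C A"
    by (simp only: laws braid_unit_left alg)
  have "(m \<cdot> ?c) \<cdot> (ide C A \<otimes> u) = (m \<cdot> (u \<otimes> ide C A)) \<cdot> braid C A (unit_obj C)"
    using braid_nat[of "ide C A" u] by simp
  then have runit: "(m \<cdot> ?c) \<cdot> (ide C A \<otimes> u) = runit C A"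
    by (simp only: laws braid_unit_right alg)
  show ?thesis
    using assoc lunit runit unfolding S opposite_def is_algebra_def prod.case
    by (simp add: in_hom_iff del: cmp_assoc_simp)
qed

lemma is_algebra_arr_opposite:
  assumes "is_algebra_arr C (S, T, f)"
  shows "is_algebra_arr C (opposite C S, opposite C T, f)"
proof -
  obtain A m u B n v where ST: "S = (A, m, u)" "T = (B, n, v)" by (cases S, cases T)
  from assms have alg: "is_algebra C (A, m, u)" "is_algebra C (B, n, v)"
    and f: "f \<in> Arr C" "src C f = A" "trg C f = B"
    and eq: "f \<cdot> m = n \<cdot> (f \<otimes> f)" "f \<cdot> u = v"
    by (auto simp: is_algebra_arr_def ST in_hom_iff)
  note [simp] = f is_algebraD(1-7)[OF alg(1)] is_algebraD(1-7)[OF alg(2)]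
  have "f \<cdot> (m \<cdot> braid C A A) = (n \<cdot> braid C B B) \<cdot> (f \<otimes> f)"
    using braid_nat[of f f] cmp_extend[OF eq(1), of "braid C A A"] by (simp del: merge)
  with eq alg[THEN is_algebra_opposite] show ?thesis
    unfolding ST opposite_def is_algebra_arr_def prod.case by (simp add: in_hom_iff)
qed

text \<open>Twisting twice by c would leave the double braiding in the multiplication; twisting back
  by its inverse leaves nothing.\<close>

lemma opposite_rev:
  assumes "is_algebra C S"
  shows "opposite (rev_braided C) (opposite C S) = S" "opposite C (opposite (rev_braided C) S) = S"
proof -
  obtain A m u where S: "S = (A, m, u)" by (cases S)
  note alg [simp] = is_algebraD(1-7)[OF assms[unfolded S]]
  show "opposite (rev_braided C) (opposite C S) = S" "opposite C (opposite (rev_braided C) S) = S"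
    by (simp_all add: S opposite_def)
qed

end

lemma fst_opposite [simp]: "fst (opposite C S) = fst S"
  by (simp add: opposite_def split: prod.splits)

section \<open>Algebras of the opposite category and coalgebras\<close>

context monoidal_category
begin

text \<open>The constraints of \<open>op_mon C\<close> are inverses; moved to the other side of each
  equation they give the coalgebra laws.\<close>

lemma is_algebra_op_mon: "is_algebra (op_mon C) S = is_coalgebra C S"
proof (cases S)
  case (fields D \<Delta> e)
  show ?thesis
  \<comment> \<open>Moving a constraint requires well-typed arrows; without them both predicates are
    false.\<close>
  proof (cases "D \<in> Obj C \<and> \<Delta> \<in> hom C D (D \<odot> D) \<and> e \<in> hom C D (unit_obj C)")
    case True
    then have [simp]: "D \<in> Obj C" "\<Delta> \<in> Arr C" "src C \<Delta> = D" "trg C \<Delta> = D \<odot> D"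
      "e \<in> Arr C" "src C e = D" "trg C e = unit_obj C"
      by (auto simp: in_hom_iff)
    have 1: "(\<Delta> \<otimes> ide C D) \<cdot> \<Delta> = inv_arr C (assoc C D D D) \<cdot> ((ide C D \<otimes> \<Delta>) \<cdot> \<Delta>)
        \<longleftrightarrow> assoc C D D D \<cdot> ((\<Delta> \<otimes> ide C D) \<cdot> \<Delta>) = (ide C D \<otimes> \<Delta>) \<cdot> \<Delta>" by (rule inv_move_left) simp_all
    have 2: "(e \<otimes> ide C D) \<cdot> \<Delta> = inv_arr C (lunit C D) \<cdot> ide C D
        \<longleftrightarrow> lunit C D \<cdot> ((e \<otimes> ide C D) \<cdot> \<Delta>) = ide C D" by (rule inv_move_left) simp_all
    have 3: "(ide C D \<otimes> e) \<cdot> \<Delta> = inv_arr C (runit C D) \<cdot> ide C D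
        \<longleftrightarrow> runit C D \<cdot> ((ide C D \<otimes> e) \<cdot> \<Delta>) = ide C D" by (rule inv_move_left) simp_all
    show ?thesis
      using True 1 2 3 by (simp add: is_algebra_def is_coalgebra_def fields)
  qed (auto simp: is_algebra_def is_coalgebra_def fields)
qed

lemma is_coalgebra_op_mon: "is_coalgebra (op_mon C) S = is_algebra C S"
proof (cases S)
  case (fields A m u)
  show ?thesis
  proof (cases "A \<in> Obj C \<and> m \<in> hom C (A \<odot> A) A \<and> u \<in> hom C (unit_obj C) A")
    case True
    then have [simp]: "A \<in> Obj C" "m \<in> Arr C" "src C m = A \<odot> A" "trg C m = A"
      "u \<in> Arr C" "src C u = unit_obj C" "trg C u = A"
      by (auto simp: in_hom_iff)
    have 1: "(m \<cdot> (m \<otimes> ide C A)) \<cdot> inv_arr C (assoc C A A A) = m \<cdot> (ide C A \<otimes> m)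
        \<longleftrightarrow> m \<cdot> (m \<otimes> ide C A) = (m \<cdot> (ide C A \<otimes> m)) \<cdot> assoc C A A A" by (rule inv_move_right) simp_all
    have 2: "(m \<cdot> (u \<otimes> ide C A)) \<cdot> inv_arr C (lunit C A) = ide C A
        \<longleftrightarrow> m \<cdot> (u \<otimes> ide C A) = ide C A \<cdot> lunit C A" by (rule inv_move_right) simp_all
    have 3: "(m \<cdot> (ide C A \<otimes> u)) \<cdot> inv_arr C (runit C A) = ide C A
        \<longleftrightarrow> m \<cdot> (ide C A \<otimes> u) = ide C A \<cdot> runit C A" by (rule inv_move_right) simp_all
    show ?thesis
      using True 1 2 3 by (simp add: is_algebra_def is_coalgebra_def fields del: merge)
  qed (auto simp: is_algebra_def is_coalgebra_def fields)
qed

lemma is_algebra_arr_op_mon: "is_algebra_arr (op_mon C) (T, S, f) = is_coalgebra_arr C (S, T, f)"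
  by (cases S; cases T) (auto simp: is_algebra_arr_def is_coalgebra_arr_def is_algebra_op_mon)

lemma is_coalgebra_arr_op_mon: "is_coalgebra_arr (op_mon C) (T, S, f) = is_algebra_arr C (S, T, f)"
  by (cases S; cases T) (auto simp: is_algebra_arr_def is_coalgebra_arr_def is_coalgebra_op_mon)

end

section \<open>Transport of adjoints along anti-isomorphisms\<close>

lemma Alg_simps [simp]:
  "S \<in> Obj (Alg C) \<longleftrightarrow> is_algebra C S" "a \<in> Arr (Alg C) \<longleftrightarrow> is_algebra_arr C a"
  "src (Alg C) (S, T, f) = S" "trg (Alg C) (S, T, f) = T" "ide (Alg C) S = (S, S, ide C (fst S))"
  "cmp (Alg C) (S', T', g) (S, T, f) = (S, T', g \<cdot>\<^bsub>C\<^esub> f)"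
  by (simp_all add: Alg_def)

lemma Coalg_simps [simp]:
  "S \<in> Obj (Coalg C) \<longleftrightarrow> is_coalgebra C S" "a \<in> Arr (Coalg C) \<longleftrightarrow> is_coalgebra_arr C a"
  "src (Coalg C) (S, T, f) = S" "trg (Coalg C) (S, T, f) = T" "ide (Coalg C) S = (S, S, ide C (fst S))"
  "cmp (Coalg C) (S', T', g) (S, T, f) = (S, T', g \<cdot>\<^bsub>C\<^esub> f)"
  by (simp_all add: Coalg_def)

section \<open>Algebras and coalgebras as categories\<close>

context monoidal_category
begin

lemma is_algebra_arrD:
  assumes "is_algebra_arr C (S, T, f)"
  shows "is_algebra C S" "is_algebra C T" "f \<in> Arr C" "src C f = fst S" "trg C f = fst T"
  using assms by (cases S; cases T; simp add: is_algebra_arr_def in_hom_iff)+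

lemma is_algebra_arr_cmp_laws:
  assumes "is_algebra_arr C (S, T, f)"
  shows "f \<cdot> ide C (fst S) = f" "ide C (fst T) \<cdot> f = f"
    "is_algebra_arr C (T, U, g) \<Longrightarrow> is_algebra_arr C (U, V, h) \<Longrightarrow> (h \<cdot> g) \<cdot> f = h \<cdot> (g \<cdot> f)"
  using assms is_algebra_arrD[of S T f] is_algebra_arrD[of T U g] is_algebra_arrD[of U V h] by simp_all

lemma is_algebra_arr_ide:
  assumes "is_algebra C S"
  shows "is_algebra_arr C (S, S, ide C (fst S))"
  using assms by (cases S) (auto simp: is_algebra_arr_def in_hom_iff is_algebraD(1-7))

lemma is_algebra_arr_cmp:
  assumes "is_algebra_arr C (S, T, f)" "is_algebra_arr C (T, U, g)"
  shows "is_algebra_arr C (S, U, g \<cdot> f)"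
proof -
  obtain A m u B n v D k w where STU: "S = (A, m, u)" "T = (B, n, v)" "U = (D, k, w)"
    by (cases S, cases T, cases U)
  from assms have alg: "is_algebra C (A, m, u)" "is_algebra C (B, n, v)" "is_algebra C (D, k, w)"
    and fg [simp]: "f \<in> Arr C" "src C f = A" "trg C f = B" "g \<in> Arr C" "src C g = B" "trg C g = D"
    and eq: "f \<cdot> m = n \<cdot> (f \<otimes> f)" "f \<cdot> u = v" "g \<cdot> n = k \<cdot> (g \<otimes> g)" "g \<cdot> v = w"
    by (auto simp: is_algebra_arr_def STU in_hom_iff)
  note [simp] = is_algebraD(1-7)[OF alg(1)] is_algebraD(1-7)[OF alg(2)] is_algebraD(1-7)[OF alg(3)]
  have "(g \<cdot> f) \<cdot> m = k \<cdot> ((g \<cdot> f) \<otimes> (g \<cdot> f))"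
    using cmp_extend[OF eq(3), of "f \<otimes> f"] by (simp add: eq(1))
  moreover have "(g \<cdot> f) \<cdot> u = w"
    by (simp add: eq(2,4))
  ultimately show ?thesis
    using alg by (simp add: is_algebra_arr_def STU in_hom_iff)
qed

lemma category_Alg: "category (Alg C)"
proof (unfold_locales, goal_cases)
  case (1 a)
  then show ?case by (cases a) (auto dest: is_algebra_arrD)
next
  case (2 a)
  then show ?case by (cases a) (auto dest: is_algebra_arrD)
next
  case (3 S)
  then show ?case by (simp add: in_hom_iff is_algebra_arr_ide)
next
  case (4 a S T b U)
  then show ?case by (cases a; cases b) (auto simp: in_hom_iff intro: is_algebra_arr_cmp)
next
  case (5 a S T)
  then show ?case by (cases a) (simp add: in_hom_iff, metis is_algebra_arr_cmp_laws(1))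
next
  case (6 a S T)
  then show ?case by (cases a) (simp add: in_hom_iff, metis is_algebra_arr_cmp_laws(2))
next
  case (7 a S T b U k V)
  then show ?case by (cases a; cases b; cases k) (simp add: in_hom_iff, metis is_algebra_arr_cmp_laws(3))
qed

text \<open>By duality from the algebras of \<open>op_mon C\<close>: arrows turn around, so the two
  identity laws trade places.\<close>

lemma category_Coalg: "category (Coalg C)"
proof -
  interpret op: monoidal_category "op_mon C"
    by (rule op_monoidal_category)
  interpret alg: category "Alg (op_mon C)"
    by (rule op.category_Alg)
  note arr = is_algebra_arr_op_mon[symmetric] and obj = is_algebra_op_mon[symmetric]
  show ?thesis
  proof (unfold_locales, goal_cases)
    case (1 a)
    then show ?case by (cases a) (auto simp: arr obj dest: op.is_algebra_arrD)
  next
    case (2 a)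
    then show ?case by (cases a) (auto simp: arr obj dest: op.is_algebra_arrD)
  next
    case (3 S)
    then show ?case using op.is_algebra_arr_ide[of S] by (auto simp: in_hom_iff arr obj)
  next
    case (4 a S T b U)
    then show ?case
      using op.is_algebra_arr_cmp by (cases a; cases b) (fastforce simp: in_hom_iff arr)
  next
    case (5 a S T)
    then show ?case by (cases a) (simp add: in_hom_iff arr, metis op.is_algebra_arr_cmp_laws(2) op_mon_simps(5,6))
  next
    case (6 a S T)
    then show ?case by (cases a) (simp add: in_hom_iff arr, metis op.is_algebra_arr_cmp_laws(1) op_mon_simps(5,6))
  next
    case (7 a S T b U k V)
    then show ?case
      by (cases a; cases b; cases k) (simp add: in_hom_iff arr, metis op.is_algebra_arr_cmp_laws(3) op_mon_simps(6))
  qed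
qed

end

lemma (in is_functor) farr_simps [simp]:
  assumes "f \<in> Arr A"
  shows "farr F f \<in> Arr B" "src B (farr F f) = fobj F (src A f)" "trg B (farr F f) = fobj F (trg A f)"
  using farr_hom[of f "src A f" "trg A f"] assms by (simp_all add: in_hom_iff)

lemma (in is_functor) farr_cmp_simp [simp]:
  assumes "f \<in> Arr A" "g \<in> Arr A" "src A g = trg A f"
  shows "farr F (g \<cdot>\<^bsub>A\<^esub> f) = farr F g \<cdot>\<^bsub>B\<^esub> farr F f"
  using farr_cmp[of f "src A f" "trg A f" g "trg A g"] assms by (simp add: in_hom_iff)

lemmas (in is_functor) fobj_Obj_simp [simp] = fobj_Obj
lemmas (in is_functor) farr_ide_simp [simp] = farr_ide

context adjunction
begin

lemma unit_simps [simp]: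
  assumes "X \<in> Obj B"
  shows "\<eta> X \<in> Arr B" "src B (\<eta> X) = X" "trg B (\<eta> X) = fobj R (fobj L X)"
  using unit_hom[OF assms] by (simp_all add: in_hom_iff)

lemma counit_simps [simp]:
  assumes "Y \<in> Obj A"
  shows "\<epsilon> Y \<in> Arr A" "src A (\<epsilon> Y) = fobj L (fobj R Y)" "trg A (\<epsilon> Y) = Y"
  using counit_hom[OF assms] by (simp_all add: in_hom_iff)

lemma unit_nat:
  "f \<in> Arr B \<Longrightarrow> \<eta> (trg B f) \<cdot>\<^bsub>B\<^esub> f = farr R (farr L f) \<cdot>\<^bsub>B\<^esub> \<eta> (src B f)"
  using unit_natural[of f "src B f" "trg B f"] by (simp add: in_hom_iff)

lemma counit_nat:
  "g \<in> Arr A \<Longrightarrow> \<epsilon> (trg A g) \<cdot>\<^bsub>A\<^esub> farr L (farr R g) = g \<cdot>\<^bsub>A\<^esub> \<epsilon> (src A g)"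
  using counit_natural[of g "src A g" "trg A g"] by (simp add: in_hom_iff)

end

text \<open>Contravariance is spelled out on plain categories because \<open>Alg\<close> and
  \<open>Coalg\<close> carry no monoidal data to which \<open>op_mon\<close> could apply.\<close>

locale contravariant_functor = A: category A + B: category B
  for A :: "('o, 'm, 'x) category_data_scheme"
    and B :: "('p, 'n, 'y) category_data_scheme"
    and F :: "('o, 'm, 'p, 'n) functor_data" +
  assumes contra_Obj [simp]: "X \<in> Obj A \<Longrightarrow> fobj F X \<in> Obj B"
    and contra_Arr [simp]: "f \<in> Arr A \<Longrightarrow> farr F f \<in> Arr B"
    and contra_src [simp]: "f \<in> Arr A \<Longrightarrow> src B (farr F f) = fobj F (trg A f)"
    and contra_trg [simp]: "f \<in> Arr A \<Longrightarrow> trg B (farr F f) = fobj F (src A f)"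
    and contra_ide [simp]: "X \<in> Obj A \<Longrightarrow> farr F (ide A X) = ide B (fobj F X)"
    and contra_cmp [simp]: "f \<in> Arr A \<Longrightarrow> g \<in> Arr A \<Longrightarrow> src A g = trg A f \<Longrightarrow>
          farr F (g \<cdot>\<^bsub>A\<^esub> f) = farr F f \<cdot>\<^bsub>B\<^esub> farr F g"

locale anti_isomorphism = F: contravariant_functor A B F + G: contravariant_functor B A G
  for A :: "('o, 'm, 'x) category_data_scheme"
    and B :: "('p, 'n, 'y) category_data_scheme"
    and F :: "('o, 'm, 'p, 'n) functor_data"
    and G :: "('p, 'n, 'o, 'm) functor_data" +
  assumes GF_Obj [simp]: "X \<in> Obj A \<Longrightarrow> fobj G (fobj F X) = X"
    and GF_Arr [simp]: "f \<in> Arr A \<Longrightarrow> farr G (farr F f) = f"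
    and FG_Obj [simp]: "Y \<in> Obj B \<Longrightarrow> fobj F (fobj G Y) = Y"
    and FG_Arr [simp]: "g \<in> Arr B \<Longrightarrow> farr F (farr G g) = g"

text \<open>Reversing arrows on both sides exchanges left and right adjoints: the counit of the
  given adjunction becomes the unit of the new one, and the triangle identities trade places.
  \<open>S\<close> is compared with the conjugate of \<open>R\<close> only on actual objects and
  arrows, since the underlying maps are total.\<close>

lemma has_right_adjoint_anti_isomorphism:
  assumes "has_left_adjoint A B R"
    and "anti_isomorphism A' A P P'" and "anti_isomorphism B B' Q Q'"
    and S_Obj: "\<And>X. X \<in> Obj A' \<Longrightarrow> fobj S X = fobj Q (fobj R (fobj P X))"
    and S_Arr: "\<And>f. f \<in> Arr A' \<Longrightarrow> farr S f = farr Q (farr R (farr P f))"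
  shows "has_right_adjoint A' B' S"
proof -
  obtain L \<eta> \<epsilon> where "adjunction A B L R \<eta> \<epsilon>"
    using assms(1) by (auto simp: has_left_adjoint_def)
  then interpret adj: adjunction A B L R \<eta> \<epsilon> .
  interpret P: anti_isomorphism A' A P P' by fact
  interpret Q: anti_isomorphism B B' Q Q' by fact
  define T where "T = \<lparr>fobj = \<lambda>Y. fobj P' (fobj L (fobj Q' Y)), farr = \<lambda>g. farr P' (farr L (farr Q' g))\<rparr>"
  have T [simp]: "fobj T Y = fobj P' (fobj L (fobj Q' Y))" "farr T g = farr P' (farr L (farr Q' g))" for Y g
    by (simp_all add: T_def)
  have "adjunction B' A' S T (\<lambda>X. farr P' (\<epsilon> (fobj P X))) (\<lambda>Y. farr Q (\<eta> (fobj Q' Y)))"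
  proof (unfold_locales, goal_cases)
    case (10 f X X')
    then have f: "f \<in> Arr A'" "src A' f = X" "trg A' f = X'" by (auto simp: in_hom_iff)
    then have [simp]: "X \<in> Obj A'" "X' \<in> Obj A'" by auto
    show ?case
      using f arg_cong[OF adj.counit_nat[of "farr P f"], of "farr P'"] by (simp add: S_Obj S_Arr)
  next
    case (12 g Y Y')
    then have g: "g \<in> Arr B'" "src B' g = Y" "trg B' g = Y'" by (auto simp: in_hom_iff)
    then have [simp]: "Y \<in> Obj B'" "Y' \<in> Obj B'" by auto
    show ?case
      using g arg_cong[OF adj.unit_nat[of "farr Q' g"], of "farr Q"] by (simp add: S_Obj S_Arr)
  next
    case (13 X)
    then show ?case
      using arg_cong[OF adj.triangle_R[of "fobj P X"], of "farr Q"] by (simp add: S_Obj S_Arr)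
  next
    case (14 Y)
    then show ?case
      using arg_cong[OF adj.triangle_L[of "fobj Q' Y"], of "farr P'"] by (simp add: S_Obj S_Arr)
  qed (auto simp: in_hom_iff S_Obj S_Arr)
  then show ?thesis
    by (auto simp: has_right_adjoint_def)
qed

section \<open>Passage to the opposite algebra as an anti-isomorphism\<close>

definition opposite_functor :: "('o, 'm, 'x) braided_data_scheme \<Rightarrow>
    (('o, 'm) structured, ('o, 'm) structured_arr, ('o, 'm) structured, ('o, 'm) structured_arr) functor_data" where
  "opposite_functor C =
    \<lparr>fobj = opposite C, farr = (\<lambda>(S, T, f). (opposite C T, opposite C S, f))\<rparr>"

lemma opposite_functor_simps [simp]:
  "fobj (opposite_functor C) S = opposite C S"
  "farr (opposite_functor C) (S, T, f) = (opposite C T, opposite C S, f)"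
  by (simp_all add: opposite_functor_def)

context braided_monoidal_category
begin

text \<open>\<open>Coalg (op_mon C)\<close> has the algebras of \<open>C\<close> as objects and
  their arrows reversed, which makes the covariant passage to opposite algebras
  contravariant.\<close>

lemma anti_isomorphism_opposite:
  "anti_isomorphism (Alg C) (Coalg (op_mon C)) (opposite_functor C) (opposite_functor (rev_braided C))"
  "anti_isomorphism (Coalg (op_mon C)) (Alg C) (opposite_functor C) (opposite_functor (rev_braided C))"
proof -
  interpret rev: braided_monoidal_category "rev_braided C"
    by (rule rev_braided_monoidal_category)
  interpret op: monoidal_category "op_mon C"
    by (rule op_monoidal_category)
  interpret alg: category "Alg C"
    by (rule category_Alg)
  interpret coalg: category "Coalg (op_mon C)"
    by (rule op.category_Coalg)
  have rev_alg: "is_algebra (rev_braided C) = is_algebra C"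
    "is_algebra_arr (rev_braided C) = is_algebra_arr C"
    by (simp_all add: fun_eq_iff is_algebra_def is_algebra_arr_def)
  have rev_opp: "is_algebra C S \<Longrightarrow> is_algebra C (opposite (rev_braided C) S)"
    "is_algebra_arr C (S, T, f) \<Longrightarrow>
      is_algebra_arr C (opposite (rev_braided C) S, opposite (rev_braided C) T, f)" for S T f
    using rev.is_algebra_opposite[of S] rev.is_algebra_arr_opposite[of S T f] by (simp_all add: rev_alg)
  have opp_rev: "opposite (rev_braided C) (opposite C S) = S" "opposite (rev_braided C) (opposite C T) = T"
    "opposite C (opposite (rev_braided C) S) = S" "opposite C (opposite (rev_braided C) T) = T"
    if "is_algebra_arr C (S, T, f)" for S T f
    using is_algebra_arrD(1,2)[OF that] by (simp_all add: opposite_rev)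
  have contra: "contravariant_functor (Alg C) (Coalg (op_mon C)) (opposite_functor D)"
    "contravariant_functor (Coalg (op_mon C)) (Alg C) (opposite_functor D)"
    if "D = C \<or> D = rev_braided C" for D
    using that by (unfold_locales; auto simp: is_coalgebra_op_mon is_coalgebra_arr_op_mon
        is_algebra_opposite is_algebra_arr_opposite rev_opp)+
  have "anti_isomorphism_axioms (Alg C) (Coalg (op_mon C)) (opposite_functor C) (opposite_functor (rev_braided C))"
    "anti_isomorphism_axioms (Coalg (op_mon C)) (Alg C) (opposite_functor C) (opposite_functor (rev_braided C))"
    by (unfold_locales; clarsimp simp: is_coalgebra_op_mon is_coalgebra_arr_op_mon opposite_rev; blast dest: opp_rev)+
  then show "anti_isomorphism (Alg C) (Coalg (op_mon C)) (opposite_functor C) (opposite_functor (rev_braided C))"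
    "anti_isomorphism (Coalg (op_mon C)) (Alg C) (opposite_functor C) (opposite_functor (rev_braided C))"
    by (auto intro: anti_isomorphism.intro contra)
qed

text \<open>The previous result in the opposite category, whose own opposite has the coalgebras of
  \<open>C\<close> again.\<close>

lemma anti_isomorphism_co_opposite:
  "anti_isomorphism (Coalg C) (Alg (op_mon C))
     (opposite_functor (op_braided C)) (opposite_functor (rev_braided (op_braided C)))"
proof -
  interpret op: braided_monoidal_category "op_braided C"
    by (rule op_braided_monoidal_category)
  have alg: "is_algebra (op_braided C) = is_coalgebra C"
    "is_algebra_arr (op_braided C) (T, S, f) = is_coalgebra_arr C (S, T, f)"
    "Alg (op_braided C) = Alg (op_mon C)" for S T f
    unfolding is_algebra_op_mon[symmetric] is_algebra_arr_op_mon[symmetric] fun_eq_iff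
    by (simp_all add: is_algebra_def is_algebra_arr_def Alg_def)
  have "Coalg (op_mon (op_braided C)) = Coalg C"
    by (auto simp: Coalg_def op.is_coalgebra_op_mon op.is_coalgebra_arr_op_mon alg)
  then show ?thesis
    using op.anti_isomorphism_opposite(2) by (simp add: alg)
qed

end

section \<open>The duality functor\<close>

locale pre_rigid_braided_category = braided_monoidal_category C
  for C :: "('o, 'm, 'x) braided_data_scheme" (structure) +
  fixes d :: "'o \<Rightarrow> 'o" and ev :: "'o \<Rightarrow> 'm"
  assumes choice: "predual_choice C d ev"
begin

sublocale rev: braided_monoidal_category "rev_braided C"
  by (rule rev_braided_monoidal_category)

lemma predual_simps [simp]:
  assumes "X \<in> Obj C"
  shows "d X \<in> Obj C" "ev X \<in> Arr C" "src C (ev X) = d X \<odot> X" "trg C (ev X) = unit_obj C"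
  using choice assms by (simp_all add: predual_choice_def is_predual_def in_hom_iff)

lemma ev_bij:
  assumes "T \<in> Obj C" "X \<in> Obj C"
  shows "bij_betw (\<lambda>u. ev X \<cdot> (u \<otimes> ide C X)) (hom C T (d X)) (hom C (T \<odot> X) (unit_obj C))"
  using choice assms by (simp add: predual_choice_def is_predual_def)

abbreviation dag :: "'o \<Rightarrow> 'o \<Rightarrow> 'm \<Rightarrow> 'm" where
  "dag \<equiv> dagger C d ev"

abbreviation dual :: "'m \<Rightarrow> 'm" where
  "dual \<equiv> farr (dual_functor C d ev)"

abbreviation \<phi>2 :: "'o \<Rightarrow> 'o \<Rightarrow> 'm" where
  "\<phi>2 \<equiv> dual_phi2 C d ev"

abbreviation \<phi>0 :: 'm where
  "\<phi>0 \<equiv> dual_phi0 C d ev"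

abbreviation \<eta> :: "'o \<Rightarrow> 'm" where
  "\<eta> \<equiv> dual_unit C d ev"

abbreviation \<epsilon> :: "'o \<Rightarrow> 'm" where
  "\<epsilon> \<equiv> dual_counit C d ev"

lemma dag_simps:
  assumes "T \<in> Obj C" "X \<in> Obj C" "t \<in> Arr C" "src C t = T \<odot> X" "trg C t = unit_obj C"
  shows "dag T X t \<in> Arr C" "src C (dag T X t) = T" "trg C (dag T X t) = d X"
    "ev X \<cdot> (dag T X t \<otimes> ide C X) = t"
proof -
  have t: "t \<in> hom C (T \<odot> X) (unit_obj C)" using assms by (simp add: in_hom_iff)
  note bij = ev_bij[OF assms(1,2)]
  have "dag T X t \<in> hom C T (d X)"
    unfolding dagger_def using the_inv_into_into[OF bij_betw_imp_inj_on[OF bij] _ order_refl] t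
    by (simp add: bij_betw_imp_surj_on[OF bij])
  then show "dag T X t \<in> Arr C" "src C (dag T X t) = T" "trg C (dag T X t) = d X"
    by (simp_all add: in_hom_iff)
  show "ev X \<cdot> (dag T X t \<otimes> ide C X) = t"
    unfolding dagger_def
    using f_the_inv_into_f[OF bij_betw_imp_inj_on[OF bij], of t] t bij_betw_imp_surj_on[OF bij] by simp
qed

text \<open>The uniqueness half of the universal property, and the way in which equations of arrows
  into a pre-dual are proved below.\<close>

lemma ev_inj:
  assumes "ev X \<cdot> (u \<otimes> ide C X) = ev X \<cdot> (v \<otimes> ide C X)" "X \<in> Obj C"
    "u \<in> Arr C" "v \<in> Arr C" "src C u = src C v" "trg C u = d X" "trg C v = d X"
  shows "u = v"
  using inj_onD[OF bij_betw_imp_inj_on[OF ev_bij[of "src C u" X]] assms(1)] assms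
  by (simp add: in_hom_iff)

lemma fobj_dual [simp]: "fobj (dual_functor C d ev) = d"
  by (simp add: dual_functor_def)

lemma dual_simps [simp]:
  assumes "f \<in> Arr C"
  shows "dual f \<in> Arr C" "src C (dual f) = d (trg C f)" "trg C (dual f) = d (src C f)"
  using assms by (simp_all add: dual_functor_def Let_def dag_simps)

text \<open>Extranaturality of evaluation: \<open>f\<close> moves from the dual side to the other.
  The factor \<open>u\<close> lets the rule act on composites.\<close>

lemma ev_dual:
  assumes "f \<in> Arr C" "u \<in> Arr C" "src C f = X" "trg C u = d (trg C f)"
  shows "ev X \<cdot> ((dual f \<cdot> u) \<otimes> ide C X) = ev (trg C f) \<cdot> (u \<otimes> f)"
proof -
  have "ev X \<cdot> (dual f \<otimes> ide C X) = ev (trg C f) \<cdot> (ide C (d (trg C f)) \<otimes> f)"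
    using assms by (auto simp add: dual_functor_def Let_def dag_simps)
  from cmp_extend[OF this, of "u \<otimes> ide C X"] show ?thesis
    using assms by auto
qed

lemma ev_dual':
  assumes "f \<in> Arr C" "src C f = X"
  shows "ev X \<cdot> (dual f \<otimes> ide C X) = ev (trg C f) \<cdot> (ide C (d (trg C f)) \<otimes> f)"
  using ev_dual[of f "ide C (d (trg C f))"] assms by simp

lemma dual_ide [simp]:
  assumes "X \<in> Obj C"
  shows "dual (ide C X) = ide C (d X)"
  by (rule ev_inj[of X]) (use assms in \<open>simp_all add: ev_dual'\<close>)

lemma dual_cmp [simp]:
  assumes "f \<in> Arr C" "g \<in> Arr C" "src C g = trg C f"
  shows "dual (g \<cdot> f) = dual f \<cdot> dual g"
proof (rule ev_inj[of "src C f"])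
  have "ev (trg C f) \<cdot> (dual g \<otimes> f) = (ev (trg C f) \<cdot> (dual g \<otimes> ide C (trg C f))) \<cdot> (ide C (d (trg C g)) \<otimes> f)"
    using assms by simp
  also have "\<dots> = ev (trg C g) \<cdot> (ide C (d (trg C g)) \<otimes> (g \<cdot> f))"
    using assms ev_dual'[of g "trg C f"] by simp
  finally show "ev (src C f) \<cdot> (dual (g \<cdot> f) \<otimes> ide C (src C f))
      = ev (src C f) \<cdot> ((dual f \<cdot> dual g) \<otimes> ide C (src C f))"
    using assms by (simp add: ev_dual ev_dual' del: merge)
qed (use assms in simp_all)

lemma is_functor_dual:
  "is_functor (op_mon C) C (dual_functor C d ev)" "is_functor C (op_mon C) (dual_functor C d ev)"
proof -
  interpret op: monoidal_category "op_mon C"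
    by (rule op_monoidal_category)
  show "is_functor (op_mon C) C (dual_functor C d ev)" "is_functor C (op_mon C) (dual_functor C d ev)"
    by (unfold_locales; auto simp: in_hom_iff)+
qed

lemma \<eta>_simps [simp]:
  assumes "X \<in> Obj C"
  shows "\<eta> X \<in> Arr C" "src C (\<eta> X) = X" "trg C (\<eta> X) = d (d X)"
    "ev (d X) \<cdot> (\<eta> X \<otimes> ide C (d X)) = ev X \<cdot> braid C X (d X)"
  using assms by (simp_all add: dual_unit_def dag_simps)

lemma \<epsilon>_simps [simp]:
  assumes "X \<in> Obj C"
  shows "\<epsilon> X \<in> Arr C" "src C (\<epsilon> X) = X" "trg C (\<epsilon> X) = d (d X)"
    "ev (d X) \<cdot> (\<epsilon> X \<otimes> ide C (d X)) = ev X \<cdot> inv_arr C (braid C (d X) X)"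
  using assms by (simp_all add: dual_counit_def dag_simps)

text \<open>Evaluation at a double dual returns to evaluation at \<open>X\<close> with the factors
  exchanged; \<open>u\<close> crosses by naturality.\<close>

lemma ev_\<eta>:
  assumes "X \<in> Obj C" "u \<in> Arr C" "trg C u = d X"
  shows "ev (d X) \<cdot> (\<eta> X \<otimes> u) = ev X \<cdot> ((u \<otimes> ide C X) \<cdot> braid C X (src C u))"
proof -
  have "ev (d X) \<cdot> (\<eta> X \<otimes> u) = (ev (d X) \<cdot> (\<eta> X \<otimes> ide C (d X))) \<cdot> (ide C X \<otimes> u)"
    using assms by (simp del: \<eta>_simps(4))
  then show ?thesis
    using assms braid_nat[of "ide C X" u] by simp
qed

lemma ev_\<epsilon>:
  assumes "X \<in> Obj C" "u \<in> Arr C" "trg C u = d X"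
  shows "ev (d X) \<cdot> (\<epsilon> X \<otimes> u) = ev X \<cdot> ((u \<otimes> ide C X) \<cdot> inv_arr C (braid C (src C u) X))"
proof -
  have "ev (d X) \<cdot> (\<epsilon> X \<otimes> u) = (ev (d X) \<cdot> (\<epsilon> X \<otimes> ide C (d X))) \<cdot> (ide C X \<otimes> u)"
    using assms by (simp del: \<epsilon>_simps(4))
  then show ?thesis
    using assms rev.braid_nat[of "ide C X" u] by simp
qed

lemma \<eta>_nat:
  assumes "f \<in> Arr C" "src C f = X" "trg C f = Y"
  shows "\<eta> Y \<cdot> f = dual (dual f) \<cdot> \<eta> X"
proof (rule ev_inj[of "d Y"])
  have [simp]: "X \<in> Obj C" "Y \<in> Obj C" using assms by auto
  have "ev (d Y) \<cdot> ((\<eta> Y \<cdot> f) \<otimes> ide C (d Y)) = (ev (d Y) \<cdot> (\<eta> Y \<otimes> ide C (d Y))) \<cdot> (f \<otimes> ide C (d Y))"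
    using assms by (simp del: \<eta>_simps(4))
  also have "\<dots> = (ev X \<cdot> (dual f \<otimes> ide C X)) \<cdot> braid C X (d Y)"
    using assms braid_nat[of f "ide C (d Y)"] by (simp add: ev_dual')
  also have "\<dots> = ev (d Y) \<cdot> ((dual (dual f) \<cdot> \<eta> X) \<otimes> ide C (d Y))"
    using assms by (simp add: ev_dual ev_\<eta>)
  finally show "ev (d Y) \<cdot> ((\<eta> Y \<cdot> f) \<otimes> ide C (d Y)) = \<dots>" .
qed (use assms in auto)

lemma \<epsilon>_nat:
  assumes "f \<in> Arr C" "src C f = X" "trg C f = Y"
  shows "\<epsilon> Y \<cdot> f = dual (dual f) \<cdot> \<epsilon> X"
proof (rule ev_inj[of "d Y"])
  have [simp]: "X \<in> Obj C" "Y \<in> Obj C" using assms by auto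
  have "ev (d Y) \<cdot> ((\<epsilon> Y \<cdot> f) \<otimes> ide C (d Y)) = (ev (d Y) \<cdot> (\<epsilon> Y \<otimes> ide C (d Y))) \<cdot> (f \<otimes> ide C (d Y))"
    using assms by (simp del: \<epsilon>_simps(4))
  also have "\<dots> = (ev X \<cdot> (dual f \<otimes> ide C X)) \<cdot> inv_arr C (braid C (d Y) X)"
    using assms rev.braid_nat[of f "ide C (d Y)"] by (simp add: ev_dual')
  also have "\<dots> = ev (d Y) \<cdot> ((dual (dual f) \<cdot> \<epsilon> X) \<otimes> ide C (d Y))"
    using assms by (simp add: ev_dual ev_\<epsilon>)
  finally show "ev (d Y) \<cdot> ((\<epsilon> Y \<cdot> f) \<otimes> ide C (d Y)) = \<dots>" .
qed (use assms in auto)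

text \<open>In each triangle identity the braiding from one of \<open>\<eta>\<close>,
  \<open>\<epsilon>\<close> meets the inverse braiding from the other, which is why the two are
  built with opposite crossings.\<close>

lemma adjunction_dual:
  "adjunction (op_mon C) C (dual_functor C d ev) (dual_functor C d ev) \<eta> \<epsilon>"
proof -
  interpret R: is_functor "op_mon C" C "dual_functor C d ev"
    by (rule is_functor_dual)
  interpret L: is_functor C "op_mon C" "dual_functor C d ev"
    by (rule is_functor_dual)
  have L: "dual (\<eta> X) \<cdot> \<epsilon> (d X) = ide C (d X)" if "X \<in> Obj C" for X
    by (rule ev_inj[of X]) (use that in \<open>simp_all add: ev_dual ev_\<epsilon> cmp_extend[OF \<eta>_simps(4)] del: L.farr_simps R.farr_simps\<close>)
  have R: "dual (\<epsilon> X) \<cdot> \<eta> (d X) = ide C (d X)" if "X \<in> Obj C" for X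
    by (rule ev_inj[of X]) (use that in \<open>simp_all add: ev_dual ev_\<eta> cmp_extend[OF \<epsilon>_simps(4)]\<close>)
  show ?thesis
    by unfold_locales (auto simp: in_hom_iff L R intro: \<eta>_nat \<epsilon>_nat \<epsilon>_nat[symmetric])
qed

section \<open>The lax structure and its mate\<close>

lemma unit_mult_rev [simp]: "unit_mult (rev_braided C) = unit_mult C"
  by (simp add: unit_mult_def)

lemma \<phi>0_simps [simp]:
  "\<phi>0 \<in> Arr C" "src C \<phi>0 = unit_obj C" "trg C \<phi>0 = d (unit_obj C)"
  "ev (unit_obj C) \<cdot> (\<phi>0 \<otimes> ide C (unit_obj C)) = unit_mult C"
  by (simp_all add: dual_phi0_def dag_simps)

lemma rev_pairing_eq:
  assumes "X \<in> Obj C" "Y \<in> Obj C"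
  shows "unit_mult C \<cdot> (ev X \<otimes> ev Y) \<cdot> dual_interchange C d X Y
    = rev.pairing (d X) (d Y) X Y (ev X) (ev Y)"
  using assms
  by (simp add: dual_interchange_def rev.pairing_def rev.middle_def rev.swap_def del: merge)

lemma \<phi>2_simps [simp]:
  assumes "X \<in> Obj C" "Y \<in> Obj C"
  shows "\<phi>2 X Y \<in> Arr C" "src C (\<phi>2 X Y) = d X \<odot> d Y" "trg C (\<phi>2 X Y) = d (X \<odot> Y)"
    "ev (X \<odot> Y) \<cdot> (\<phi>2 X Y \<otimes> ide C (X \<odot> Y)) = rev.pairing (d X) (d Y) X Y (ev X) (ev Y)"
  unfolding dual_phi2_def rev_pairing_eq[OF assms]
  using assms rev.pairing_simps[of "d X" "d Y" X Y "ev X" "ev Y"] by (simp_all add: dag_simps)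

text \<open>Translates each law of \<open>\<phi>2\<close>, after evaluation, into a law of pairings
  in the reversed category.\<close>

lemma ev_\<phi>2:
  assumes "X \<in> Obj C" "Y \<in> Obj C" "k \<in> Arr C" "trg C k = d X" "e \<in> Arr C" "trg C e = d Y"
    "x \<in> Arr C" "trg C x = X" "y \<in> Arr C" "trg C y = Y"
  shows "ev (X \<odot> Y) \<cdot> ((\<phi>2 X Y \<cdot> (k \<otimes> e)) \<otimes> (x \<otimes> y))
    = rev.pairing (src C k) (src C e) (src C x) (src C y) (ev X \<cdot> (k \<otimes> x)) (ev Y \<cdot> (e \<otimes> y))"
proof -
  have "ev (X \<odot> Y) \<cdot> ((\<phi>2 X Y \<cdot> (k \<otimes> e)) \<otimes> (x \<otimes> y))
    = (ev (X \<odot> Y) \<cdot> (\<phi>2 X Y \<otimes> ide C (X \<odot> Y))) \<cdot> ((k \<otimes> e) \<otimes> (x \<otimes> y))"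
    using assms by (simp del: \<phi>2_simps(4))
  then show ?thesis
    using assms rev.pairing_nat[of "d X" "d Y" X Y "ev X" "ev Y" k e x y] by simp
qed

lemma lax_monoidal_functor_dual:
  "lax_monoidal_functor (op_mon C) C (dual_functor C d ev) \<phi>2 \<phi>0"
proof -
  interpret op: monoidal_category "op_mon C"
    by (rule op_monoidal_category)
  interpret R: is_functor "op_mon C" C "dual_functor C d ev"
    by (rule is_functor_dual)
  have nat: "\<phi>2 X' Y' \<cdot> (dual f \<otimes> dual g) = dual (f \<otimes> g) \<cdot> \<phi>2 X Y"
    if f [simp]: "f \<in> Arr C" "src C f = X'" "trg C f = X" "g \<in> Arr C" "src C g = Y'" "trg C g = Y"
    for f g X X' Y Y'
  proof -
    have [simp]: "X \<in> Obj C" "X' \<in> Obj C" "Y \<in> Obj C" "Y' \<in> Obj C"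
      using src_mem[OF f(1)] trg_mem[OF f(1)] src_mem[OF f(4)] trg_mem[OF f(4)] by simp_all
    \<comment> \<open>Identities on products are written as products of identities to fit
      \<open>ev_\<phi>2\<close>. Both sides then evaluate to one pairing, since evaluation is
      extranatural.\<close>
    have "ev (X' \<odot> Y') \<cdot> ((\<phi>2 X' Y' \<cdot> (dual f \<otimes> dual g)) \<otimes> (ide C X' \<otimes> ide C Y'))
        = ev (X \<odot> Y) \<cdot> ((\<phi>2 X Y \<cdot> (ide C (d X) \<otimes> ide C (d Y))) \<otimes> (f \<otimes> g))"
      by (simp only: ev_\<phi>2 dual_simps ide_simps predual_simps f ev_dual' \<open>X \<in> Obj C\<close> \<open>X' \<in> Obj C\<close>
          \<open>Y \<in> Obj C\<close> \<open>Y' \<in> Obj C\<close>)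
    then have "ev (X' \<odot> Y') \<cdot> ((\<phi>2 X' Y' \<cdot> (dual f \<otimes> dual g)) \<otimes> ide C (X' \<odot> Y'))
      = ev (X' \<odot> Y') \<cdot> ((dual (f \<otimes> g) \<cdot> \<phi>2 X Y) \<otimes> ide C (X' \<odot> Y'))"
      by (simp add: ev_dual)
    then show ?thesis
      by (rule ev_inj) simp_all
  qed
  have assoc: "dual (inv_arr C (assoc C X Y Z)) \<cdot> (\<phi>2 (X \<odot> Y) Z \<cdot> (\<phi>2 X Y \<otimes> ide C (d Z)))
      = \<phi>2 X (Y \<odot> Z) \<cdot> ((ide C (d X) \<otimes> \<phi>2 Y Z) \<cdot> assoc C (d X) (d Y) (d Z))"
    if [simp]: "X \<in> Obj C" "Y \<in> Obj C" "Z \<in> Obj C" for X Y Z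
  proof (rule ev_inj[of "X \<odot> (Y \<odot> Z)"])
    let ?a = "assoc C X Y Z" and ?b = "assoc C (d X) (d Y) (d Z)"
    let ?f = "\<phi>2 (X \<odot> Y) Z \<cdot> (\<phi>2 X Y \<otimes> ide C (d Z))" and ?g = "\<phi>2 X (Y \<odot> Z) \<cdot> (ide C (d X) \<otimes> \<phi>2 Y Z)"
    have l: "ev ((X \<odot> Y) \<odot> Z) \<cdot> (?f \<otimes> (ide C (X \<odot> Y) \<otimes> ide C Z))
      = rev.pairing (d X \<odot> d Y) (d Z) (X \<odot> Y) Z (rev.pairing (d X) (d Y) X Y (ev X) (ev Y)) (ev Z)"
      by (subst ev_\<phi>2) simp_all
    have r: "ev (X \<odot> (Y \<odot> Z)) \<cdot> (?g \<otimes> (ide C X \<otimes> ide C (Y \<odot> Z)))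
      = rev.pairing (d X) (d Y \<odot> d Z) X (Y \<odot> Z) (ev X) (rev.pairing (d Y) (d Z) Y Z (ev Y) (ev Z))"
      by (subst ev_\<phi>2) simp_all
    have "ev ((X \<odot> Y) \<odot> Z) \<cdot> (?f \<otimes> (ide C (X \<odot> Y) \<otimes> ide C Z))
        = (ev (X \<odot> (Y \<odot> Z)) \<cdot> (?g \<otimes> (ide C X \<otimes> ide C (Y \<odot> Z)))) \<cdot> (?b \<otimes> ?a)"
      unfolding l r
      using rev.pairing_assoc[of "d X" "d Y" "d Z" X Y Z "ev X" "ev Y" "ev Z"] by simp
    \<comment> \<open>Composing with the inverse associator matches the constraint of
      \<open>op_mon C\<close>, whose dual appears in the claim.\<close>
    then have "(ev ((X \<odot> Y) \<odot> Z) \<cdot> (?f \<otimes> (ide C (X \<odot> Y) \<otimes> ide C Z))) \<cdot> (ide C ((d X \<odot> d Y) \<odot> d Z) \<otimes> inv_arr C ?a)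
        = ((ev (X \<odot> (Y \<odot> Z)) \<cdot> (?g \<otimes> (ide C X \<otimes> ide C (Y \<odot> Z)))) \<cdot> (?b \<otimes> ?a)) \<cdot> (ide C ((d X \<odot> d Y) \<odot> d Z) \<otimes> inv_arr C ?a)"
      by (simp only:)
    then show "ev (X \<odot> (Y \<odot> Z)) \<cdot> ((dual (inv_arr C ?a) \<cdot> ?f) \<otimes> ide C (X \<odot> (Y \<odot> Z)))
        = ev (X \<odot> (Y \<odot> Z)) \<cdot> ((\<phi>2 X (Y \<odot> Z) \<cdot> ((ide C (d X) \<otimes> \<phi>2 Y Z) \<cdot> ?b)) \<otimes> ide C (X \<odot> (Y \<odot> Z)))"
      by (simp add: ev_dual)
  qed simp_all
  have lunit: "dual (inv_arr C (lunit C X)) \<cdot> (\<phi>2 (unit_obj C) X \<cdot> (\<phi>0 \<otimes> ide C (d X))) = lunit C (d X)"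
    if [simp]: "X \<in> Obj C" for X
  proof (rule ev_inj[of X])
    have *: "ev (unit_obj C \<odot> X) \<cdot> ((\<phi>2 (unit_obj C) X \<cdot> (\<phi>0 \<otimes> ide C (d X))) \<otimes> (ide C (unit_obj C) \<otimes> ide C X))
        = rev.pairing (unit_obj C) (d X) (unit_obj C) X (unit_mult C) (ev X)"
      by (subst ev_\<phi>2) simp_all
    show "ev X \<cdot> ((dual (inv_arr C (lunit C X)) \<cdot> (\<phi>2 (unit_obj C) X \<cdot> (\<phi>0 \<otimes> ide C (d X)))) \<otimes> ide C X)
        = ev X \<cdot> (lunit C (d X) \<otimes> ide C X)"
      using rev.pairing_unit_left[of "d X" X "ev X"]
      by (simp add: *[symmetric] ev_dual)
  qed simp_all
  have runit: "dual (inv_arr C (runit C X)) \<cdot> (\<phi>2 X (unit_obj C) \<cdot> (ide C (d X) \<otimes> \<phi>0)) = runit C (d X)"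
    if [simp]: "X \<in> Obj C" for X
  proof (rule ev_inj[of X])
    have *: "ev (X \<odot> unit_obj C) \<cdot> ((\<phi>2 X (unit_obj C) \<cdot> (ide C (d X) \<otimes> \<phi>0)) \<otimes> (ide C X \<otimes> ide C (unit_obj C)))
        = rev.pairing (d X) (unit_obj C) X (unit_obj C) (ev X) (unit_mult C)"
      by (subst ev_\<phi>2) simp_all
    show "ev X \<cdot> ((dual (inv_arr C (runit C X)) \<cdot> (\<phi>2 X (unit_obj C) \<cdot> (ide C (d X) \<otimes> \<phi>0))) \<otimes> ide C X)
        = ev X \<cdot> (runit C (d X) \<otimes> ide C X)"
      using rev.pairing_unit_right[of "d X" X "ev X"]
      by (simp add: *[symmetric] ev_dual)
  qed simp_all
  show ?thesis
  proof (unfold_locales, goal_cases)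
    case (2 f X X' g Y Y')
    then show ?case by (simp add: in_hom_iff nat)
  qed (simp_all add: in_hom_iff assoc lunit runit del: merge)
qed

text \<open>The units contribute c at each factor and the counit contributes an inverse braiding of
  the two whole products. \<open>pairing_braid\<close> says how these combine.\<close>

lemma colax2_dual:
  assumes [simp]: "X \<in> Obj C" "Y \<in> Obj C"
  shows "colax2 (op_mon C) C (dual_functor C d ev) \<eta> \<epsilon> \<phi>2 X Y
    = dual (braid C X Y) \<cdot> (\<phi>2 Y X \<cdot> braid C (d X) (d Y))"
proof (rule ev_inj[of "X \<odot> Y"])
  let ?T = "d X \<odot> d Y" and ?\<psi> = "colax2 (op_mon C) C (dual_functor C d ev) \<eta> \<epsilon> \<phi>2 X Y"
  have \<psi>: "?\<psi> = dual (\<eta> X \<otimes> \<eta> Y) \<cdot> (dual (\<phi>2 (d X) (d Y)) \<cdot> \<epsilon> ?T)"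
    by (simp add: colax2_def)
  have "ev (X \<odot> Y) \<cdot> (?\<psi> \<otimes> ide C (X \<odot> Y))
      = (ev (d (d X) \<odot> d (d Y)) \<cdot> ((dual (\<phi>2 (d X) (d Y)) \<cdot> \<epsilon> ?T) \<otimes> ide C (d (d X) \<odot> d (d Y)))) \<cdot> (ide C ?T \<otimes> (\<eta> X \<otimes> \<eta> Y))"
    unfolding \<psi> by (simp add: ev_dual[of "\<eta> X \<otimes> \<eta> Y"])
  also have "\<dots> = ev (d ?T) \<cdot> (\<epsilon> ?T \<otimes> (\<phi>2 (d X) (d Y) \<cdot> (\<eta> X \<otimes> \<eta> Y)))"
    by (simp add: ev_dual)
  \<comment> \<open>Here the counit brings evaluation at \<open>d ?T\<close> back to
    \<open>?T\<close>, at the price of the inverse braiding.\<close>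
  also have "\<dots> = (ev ?T \<cdot> ((\<phi>2 (d X) (d Y) \<cdot> (\<eta> X \<otimes> \<eta> Y)) \<otimes> (ide C (d X) \<otimes> ide C (d Y)))) \<cdot> inv_arr C (braid C (X \<odot> Y) ?T)"
    by (simp add: ev_\<epsilon>)
  also have "\<dots> = rev.pairing X Y (d X) (d Y) (ev X \<cdot> braid C X (d X)) (ev Y \<cdot> braid C Y (d Y)) \<cdot> inv_arr C (braid C (X \<odot> Y) ?T)"
    by (subst ev_\<phi>2) simp_all
  \<comment> \<open>\<open>pairing_braid\<close> supplies the braiding that cancels this inverse;
    two parallel crossings remain.\<close>
  also have "\<dots> = rev.pairing (d Y) (d X) Y X (ev Y) (ev X) \<cdot> (braid C (d X) (d Y) \<otimes> braid C X Y)"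
    using rev.pairing_simps[of "d Y" "d X" Y X "ev Y" "ev X"] by (simp add: pairing_braid)
  also have "\<dots> = ev (X \<odot> Y) \<cdot> ((dual (braid C X Y) \<cdot> (\<phi>2 Y X \<cdot> braid C (d X) (d Y))) \<otimes> ide C (X \<odot> Y))"
    by (simp add: ev_dual flip: \<phi>2_simps(4))
  finally show "ev (X \<odot> Y) \<cdot> (?\<psi> \<otimes> ide C (X \<odot> Y)) = \<dots>" .
qed (simp_all add: colax2_def)

lemma colax0_dual: "colax0 (op_mon C) (dual_functor C d ev) \<epsilon> \<phi>0 = \<phi>0"
  by (rule ev_inj[of "unit_obj C"]) (simp_all add: colax0_def ev_dual ev_\<epsilon> braid_unit_unit)

lemma has_right_adjoint_dual:
  assumes "has_left_adjoint (Alg (op_mon C)) (Alg C) (Alg_functor C (dual_functor C d ev) \<phi>2 \<phi>0)"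
  shows "has_right_adjoint (Coalg C) (Coalg (op_mon C))
    (Coalg_functor (op_mon C) (dual_functor C d ev)
      (colax2 (op_mon C) C (dual_functor C d ev) \<eta> \<epsilon> \<phi>2) (colax0 (op_mon C) (dual_functor C d ev) \<epsilon> \<phi>0))"
    (is "has_right_adjoint _ _ ?S")
proof (rule has_right_adjoint_anti_isomorphism[OF assms anti_isomorphism_co_opposite anti_isomorphism_opposite(1)])
  let ?R = "Alg_functor C (dual_functor C d ev) \<phi>2 \<phi>0"
  show obj: "fobj ?S S = fobj (opposite_functor C) (fobj ?R (fobj (opposite_functor (op_braided C)) S))"
    if "S \<in> Obj (Coalg C)" for S
  proof -
    obtain D \<Delta> e where S: "S = (D, \<Delta>, e)" by (cases S)
    have [simp]: "D \<in> Obj C" "\<Delta> \<in> Arr C" "src C \<Delta> = D" "trg C \<Delta> = D \<odot> D"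
      "e \<in> Arr C" "src C e = D" "trg C e = unit_obj C"
      using that by (auto simp: S is_coalgebra_def in_hom_iff)
    \<comment> \<open>Dualizing c after \<open>\<Delta>\<close> yields \<open>dual \<Delta>\<close>
      after the dual of c, and the final opposite appends the braiding of \<open>d D\<close> with
      itself. This is \<open>dual \<Delta>\<close> after the mate at \<open>D\<close>,
      \<open>D\<close>.\<close>
    show ?thesis
      by (simp add: S Coalg_functor_def Alg_functor_def Let_def opposite_def colax2_dual colax0_dual)
  qed
  show "farr ?S a = farr (opposite_functor C) (farr ?R (farr (opposite_functor (op_braided C)) a))"
    if "a \<in> Arr (Coalg C)" for a
  proof -
    obtain S T f where a: "a = (S, T, f)" by (cases a)
    interpret coalg: category "Coalg C"
      by (rule category_Coalg)
    \<comment> \<open>Both functors send the underlying arrow to its dual, and the two reversals of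
      direction cancel; only the endpoints need comparing.\<close>
    have "S \<in> Obj (Coalg C)" "T \<in> Obj (Coalg C)"
      using coalg.src_Obj[OF that] coalg.trg_Obj[OF that] by (simp_all add: a)
    from obj[OF this(1)] obj[OF this(2)] show ?thesis
      by (simp add: a Coalg_functor_def Alg_functor_def Let_def)
  qed
qed

end

theorem corollary4p7:
  fixes C :: "('o, 'm) braided_data"
    and d :: "'o \<Rightarrow> 'o" and ev :: "'o \<Rightarrow> 'm"
  assumes "braided_monoidal_category C"
    and "predual_choice C d ev"
    and "has_left_adjoint (Alg (op_mon C)) (Alg C)
           (Alg_functor C (dual_functor C d ev) (dual_phi2 C d ev) (dual_phi0 C d ev))"
  shows "liftable_pair (op_mon C) C (dual_functor C d ev) (dual_functor C d ev)
           (dual_unit C d ev) (dual_counit C d ev) (dual_phi2 C d ev) (dual_phi0 C d ev)"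
proof -
  interpret pre_rigid_braided_category C d ev
    using assms(1,2) by (simp add: pre_rigid_braided_category_def pre_rigid_braided_category_axioms_def)
  show ?thesis
    using lax_monoidal_functor_dual adjunction_dual assms(3) has_right_adjoint_dual[OF assms(3)]
    by (simp add: liftable_pair_def)
qed

end
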